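(* Assume the setting of the context. Let $S\subset M$ be compact with $Cov(S;\varepsilon)\le C\varepsilon^{-k}$ for some $C,k\in(0,\infty)$ and all $\varepsilon\in(0,\operatorname{diam}S]$. Let $\varphi$ be a scale function and $\psi:[0,\infty)\to[0,\infty)$ a continuous nondecreasing function with $\psi(0)=0$ such that $$L(\rho):=\limsup_{n\to\infty}\mathcal M_{V_n}(S)^k\,\psi\big(\mathcal M_{V_n}(S)\,\rho^{1/\varphi(n)}\big)<\infty\quad\text{for all }\rho\in(0,1).$$ Then for every $f\in\mathfrak B_\varphi((A,V);B;\alpha)$, $\mathcal H^{\psi_k}_{M\times B}(\Gamma_f(S))<\infty$, where $\psi_k(t)=t^k\psi(t)$ and $\Gamma_f(S)=\{(s,f(s)):s\in S\}$.
   Context: $\mathbb F\in\{\mathbb R,\mathbb C\}$. $(M,d)$ is a compact metric space; $A$ is an infinite-dimensional separable Banach space of continuous $\mathbb F$-valued functions on $M$ with $\|\cdot\|_A\ge\|\cdot\|_{C(M)}$ (sup norm); $V_0\subsetneq V_1\subsetneq\cdots$ are finite-dimensional subspaces of $A$ consisting of Lipschitz functions, with dense union $V$. $B$ is a Banach space over $\mathbb F$ and $\alpha$ a uniform crossnorm (a reasonable crossnorm assigned functorially so that $\|S\otimes T\|\le\|S\|\|T\|$); then $A\hat\otimes_\alpha B$ consists of continuous $B$-valued functions on $M$. $E_n(x)=\inf_{h\in V_n\otimes B}\|x-h\|_{A\hat\otimes_\alpha B}$; for a scale function $\varphi$ (nonincreasing $\mathbb N\to(0,\infty)$, $\varphi(n)\to0$),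 $\mathfrak B_\varphi((A,V);B;\alpha)=\{x:\liminf_nE_n(x)^{\varphi(n)}<1\}$. Covering number: $Cov(S;\varepsilon)$ is the minimal number of open balls of radius $\varepsilon$ centered at points of $S$ covering $S$. Markov constant: $\mathcal M_{V_i}(S):=\sup\{|f(x)-f(y)|/d(x,y): f\in V_i,\ \|f\|_{C(M)}\le1,\ x\neq y\in S\}$. $M\times B$ carries the metric $\max\{d(m_1,m_2),\|b_1-b_2\|_B\}$. For a gauge function $\psi$ (nondecreasing, $\psi(0)=0$), $\mathcal H^\psi_X$ is the $\psi$-Hausdorff measure on a metric space $X$: $\lim_{\delta\to0^+}\inf\{\sum_i\psi(\operatorname{diam}U_i): E\subset\bigcup U_i,\ \operatorname{diam}U_i\le\delta\}$. *)

theory Defs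
  imports "HOL-Analysis.Analysis"
begin

text \<open>The scalar field F is a type of class real_normed_field (up to isomorphism
these are exactly R and C).  B is a real Banach space together with an
F-scalar multiplication fsc compatible with the real structure and the norm.\<close>

definition F_module :: "('f::real_normed_field \<Rightarrow> 'b::banach \<Rightarrow> 'b) \<Rightarrow> bool" where
  "F_module fsc \<longleftrightarrow>
     (\<forall>c x y. fsc c (x + y) = fsc c x + fsc c y) \<and>
     (\<forall>c d x. fsc (c + d) x = fsc c x + fsc d x) \<and>
     (\<forall>c d x. fsc (c * d) x = fsc c (fsc d x)) \<and>
     (\<forall>x. fsc 1 x = x) \<and>
     (\<forall>r x. fsc (of_real r) x = r *\<^sub>R x) \<and>
     (\<forall>c x. norm (fsc c x) = norm c * norm x)"

definition fun_subspace :: "('f \<Rightarrow> 'v \<Rightarrow> 'v) \<Rightarrow> ('m \<Rightarrow> 'v::real_normed_vector) set \<Rightarrow> bool" where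
  "fun_subspace sc W \<longleftrightarrow> (\<lambda>m. 0) \<in> W \<and> (\<forall>x\<in>W. \<forall>y\<in>W. (\<lambda>m. x m + y m) \<in> W) \<and>
     (\<forall>c. \<forall>x\<in>W. (\<lambda>m. sc c (x m)) \<in> W)"

definition fun_norm_on :: "('f::real_normed_field \<Rightarrow> 'v \<Rightarrow> 'v) \<Rightarrow> ('m \<Rightarrow> 'v::real_normed_vector) set
    \<Rightarrow> (('m \<Rightarrow> 'v) \<Rightarrow> real) \<Rightarrow> bool" where
  "fun_norm_on sc W N \<longleftrightarrow> (\<forall>x\<in>W. 0 \<le> N x \<and> (N x = 0 \<longleftrightarrow> x = (\<lambda>m. 0))) \<and>
     (\<forall>x\<in>W. \<forall>y\<in>W. N (\<lambda>m. x m + y m) \<le> N x + N y) \<and>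
     (\<forall>c. \<forall>x\<in>W. N (\<lambda>m. sc c (x m)) = norm c * N x)"

definition fun_complete :: "('m \<Rightarrow> 'v::real_normed_vector) set \<Rightarrow> (('m \<Rightarrow> 'v) \<Rightarrow> real) \<Rightarrow> bool" where
  "fun_complete W N \<longleftrightarrow> (\<forall>u. (\<forall>k. u k \<in> W) \<and>
       (\<forall>e>0. \<exists>K. \<forall>j\<ge>K. \<forall>l\<ge>K. N (\<lambda>m. u j m - u l m) < e) \<longrightarrow>
       (\<exists>x\<in>W. (\<lambda>k. N (\<lambda>m. u k m - x m)) \<longlonglongrightarrow> 0))"

definition fun_dense :: "('m \<Rightarrow> 'v::real_normed_vector) set \<Rightarrow> ('m \<Rightarrow> 'v) set
    \<Rightarrow> (('m \<Rightarrow> 'v) \<Rightarrow> real) \<Rightarrow> bool" where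
  "fun_dense D W N \<longleftrightarrow> D \<subseteq> W \<and> (\<forall>x\<in>W. \<forall>e>0. \<exists>d\<in>D. N (\<lambda>m. x m - d m) < e)"

definition fun_span :: "('m \<Rightarrow> 'f::real_normed_field) set \<Rightarrow> ('m \<Rightarrow> 'f) set" where
  "fun_span G = {(\<lambda>m. \<Sum>i<n. c i * g i m) | (n::nat) c g. \<forall>i<n. g i \<in> G}"

definition fin_dim_fun :: "('m \<Rightarrow> 'f::real_normed_field) set \<Rightarrow> bool" where
  "fin_dim_fun W \<longleftrightarrow> (\<exists>G. finite G \<and> G \<subseteq> W \<and> fun_span G = W)"

text \<open>Algebraic tensor product G (x) B, realised as B-valued functions
  m |-> sum_i a_i(m) b_i.\<close>
definition tens :: "('f::real_normed_field \<Rightarrow> 'b::banach \<Rightarrow> 'b) \<Rightarrow> ('m \<Rightarrow> 'f) set \<Rightarrow> ('m \<Rightarrow> 'b) set" where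
  "tens fsc G = {(\<lambda>m. \<Sum>i<n. fsc (a i m) (b i)) | (n::nat) a b. \<forall>i<n. a i \<in> G}"

definition bdd_functional_A :: "('m \<Rightarrow> 'f::real_normed_field) set \<Rightarrow> (('m \<Rightarrow> 'f) \<Rightarrow> real)
    \<Rightarrow> (('m \<Rightarrow> 'f) \<Rightarrow> 'f) \<Rightarrow> real \<Rightarrow> bool" where
  "bdd_functional_A A NA \<phi> c \<longleftrightarrow>
     (\<forall>x\<in>A. \<forall>y\<in>A. \<phi> (\<lambda>m. x m + y m) = \<phi> x + \<phi> y) \<and>
     (\<forall>d. \<forall>x\<in>A. \<phi> (\<lambda>m. d * x m) = d * \<phi> x) \<and>
     (\<forall>x\<in>A. norm (\<phi> x) \<le> c * NA x)"

definition bdd_functional_B :: "('f::real_normed_field \<Rightarrow> 'b::banach \<Rightarrow> 'b) \<Rightarrow> ('b \<Rightarrow> 'f) \<Rightarrow> real \<Rightarrow> bool" where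
  "bdd_functional_B fsc \<psi> c \<longleftrightarrow>
     (\<forall>x y. \<psi> (x + y) = \<psi> x + \<psi> y) \<and> (\<forall>d x. \<psi> (fsc d x) = d * \<psi> x) \<and>
     (\<forall>x. norm (\<psi> x) \<le> c * norm x)"

definition bdd_operator_A :: "('m \<Rightarrow> 'f::real_normed_field) set \<Rightarrow> (('m \<Rightarrow> 'f) \<Rightarrow> real)
    \<Rightarrow> (('m \<Rightarrow> 'f) \<Rightarrow> ('m \<Rightarrow> 'f)) \<Rightarrow> real \<Rightarrow> bool" where
  "bdd_operator_A A NA S c \<longleftrightarrow> (\<forall>x\<in>A. S x \<in> A) \<and>
     (\<forall>x\<in>A. \<forall>y\<in>A. S (\<lambda>m. x m + y m) = (\<lambda>m. S x m + S y m)) \<and>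
     (\<forall>d. \<forall>x\<in>A. S (\<lambda>m. d * x m) = (\<lambda>m. d * S x m)) \<and>
     (\<forall>x\<in>A. NA (S x) \<le> c * NA x)"

definition bdd_operator_B :: "('f::real_normed_field \<Rightarrow> 'b::banach \<Rightarrow> 'b) \<Rightarrow> ('b \<Rightarrow> 'b) \<Rightarrow> real \<Rightarrow> bool" where
  "bdd_operator_B fsc T c \<longleftrightarrow>
     (\<forall>x y. T (x + y) = T x + T y) \<and> (\<forall>d x. T (fsc d x) = fsc d (T x)) \<and>
     (\<forall>x. norm (T x) \<le> c * norm x)"

definition approx_setting :: "('m::metric_space \<Rightarrow> 'f::real_normed_field) set \<Rightarrow> (('m \<Rightarrow> 'f) \<Rightarrow> real)
    \<Rightarrow> (nat \<Rightarrow> ('m \<Rightarrow> 'f) set) \<Rightarrow> bool" where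
  "approx_setting A NA V \<longleftrightarrow>
     compact (UNIV :: 'm set) \<and>
     fun_subspace (*) A \<and> (\<forall>f\<in>A. continuous_on UNIV f) \<and>
     fun_norm_on (*) A NA \<and> fun_complete A NA \<and>
     (\<exists>D. countable D \<and> fun_dense D A NA) \<and>
     \<not> fin_dim_fun A \<and>
     (\<forall>f\<in>A. \<forall>m. norm (f m) \<le> NA f) \<and>
     (\<forall>n. V n \<subseteq> A \<and> fun_subspace (*) (V n) \<and> fin_dim_fun (V n)) \<and>
     (\<forall>n. V n \<subset> V (Suc n)) \<and>
     (\<forall>n. \<forall>f\<in>V n. \<exists>L. L-lipschitz_on UNIV f) \<and>
     fun_dense (\<Union>n. V n) A NA"

text \<open>(X, Nalpha) is the completed tensor product A \<hat>\<otimes>_alpha B for a uniform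
crossnorm alpha, realised (as in the paper) as a space of continuous B-valued
functions on M: it contains the algebraic tensor product A (x) B as a dense
subspace, Nalpha is a reasonable crossnorm on A (x) B satisfying the uniform
property, X is complete, and the identification with functions is the one
obtained by continuous extension (Nalpha-limits of algebraic tensors are
pointwise limits).\<close>
definition tensor_completion ::
  "('f::real_normed_field \<Rightarrow> 'b::banach \<Rightarrow> 'b) \<Rightarrow> ('m::metric_space \<Rightarrow> 'f) set \<Rightarrow> (('m \<Rightarrow> 'f) \<Rightarrow> real)
    \<Rightarrow> ('m \<Rightarrow> 'b) set \<Rightarrow> (('m \<Rightarrow> 'b) \<Rightarrow> real) \<Rightarrow> bool" where
  "tensor_completion fsc A NA X Nalpha \<longleftrightarrow>
     fun_subspace fsc X \<and> tens fsc A \<subseteq> X \<and> (\<forall>x\<in>X. continuous_on UNIV x) \<and>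
     fun_norm_on fsc X Nalpha \<and> fun_complete X Nalpha \<and> fun_dense (tens fsc A) X Nalpha \<and>
     (\<forall>x\<in>X. \<forall>u. (\<forall>k. u k \<in> tens fsc A) \<and> (\<lambda>k. Nalpha (\<lambda>m. u k m - x m)) \<longlonglongrightarrow> 0 \<longrightarrow>
        (\<forall>m. (\<lambda>k. u k m) \<longlonglongrightarrow> x m)) \<and>
     \<comment> \<open>crossnorm bound\<close>
     (\<forall>a\<in>A. \<forall>b. Nalpha (\<lambda>m. fsc (a m) b) \<le> NA a * norm b) \<and>
     \<comment> \<open>dual crossnorm bound (reasonable crossnorm)\<close>
     (\<forall>\<phi> c\<phi> \<psi> c\<psi> (n::nat) a b. bdd_functional_A A NA \<phi> c\<phi> \<and> bdd_functional_B fsc \<psi> c\<psi> \<and>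
        (\<forall>i<n. a i \<in> A) \<longrightarrow>
        norm (\<Sum>i<n. \<phi> (a i) * \<psi> (b i)) \<le> c\<phi> * c\<psi> * Nalpha (\<lambda>m. \<Sum>i<n. fsc (a i m) (b i))) \<and>
     \<comment> \<open>uniform property: norm of S (x) T at most norm S times norm T\<close>
     (\<forall>S cS T cT (n::nat) a b. bdd_operator_A A NA S cS \<and> bdd_operator_B fsc T cT \<and>
        (\<forall>i<n. a i \<in> A) \<longrightarrow>
        Nalpha (\<lambda>m. \<Sum>i<n. fsc (S (a i) m) (T (b i)))
          \<le> cS * cT * Nalpha (\<lambda>m. \<Sum>i<n. fsc (a i m) (b i)))"

definition scale_function :: "(nat \<Rightarrow> real) \<Rightarrow> bool" where
  "scale_function \<phi> \<longleftrightarrow> (\<forall>n. \<phi> n > 0) \<and> (\<forall>n. \<phi> (Suc n) \<le> \<phi> n) \<and> \<phi> \<longlonglongrightarrow> 0"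

definition approx_err :: "('f::real_normed_field \<Rightarrow> 'b::banach \<Rightarrow> 'b) \<Rightarrow> (('m \<Rightarrow> 'b) \<Rightarrow> real)
    \<Rightarrow> (nat \<Rightarrow> ('m \<Rightarrow> 'f) set) \<Rightarrow> nat \<Rightarrow> ('m \<Rightarrow> 'b) \<Rightarrow> real" where
  "approx_err fsc Nalpha V n x = Inf {Nalpha (\<lambda>m. x m - h m) | h. h \<in> tens fsc (V n)}"

definition approx_class :: "(nat \<Rightarrow> real) \<Rightarrow> ('f::real_normed_field \<Rightarrow> 'b::banach \<Rightarrow> 'b)
    \<Rightarrow> ('m \<Rightarrow> 'b) set \<Rightarrow> (('m \<Rightarrow> 'b) \<Rightarrow> real) \<Rightarrow> (nat \<Rightarrow> ('m \<Rightarrow> 'f) set) \<Rightarrow> ('m \<Rightarrow> 'b) set" where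
  "approx_class \<phi> fsc X Nalpha V =
     {x \<in> X. Liminf sequentially (\<lambda>n. ereal (approx_err fsc Nalpha V n x powr \<phi> n)) < 1}"

definition cov_num :: "'a::metric_space set \<Rightarrow> real \<Rightarrow> nat" where
  "cov_num S \<epsilon> = (LEAST n. \<exists>T. T \<subseteq> S \<and> finite T \<and> card T = n \<and> S \<subseteq> (\<Union>t\<in>T. ball t \<epsilon>))"

definition markov_const :: "('m::metric_space \<Rightarrow> 'f::real_normed_field) set \<Rightarrow> 'm set \<Rightarrow> real" where
  "markov_const W S = Sup (insert 0 {norm (f x - f y) / dist x y | f x y.
       f \<in> W \<and> (\<forall>m. norm (f m) \<le> 1) \<and> x \<in> S \<and> y \<in> S \<and> x \<noteq> y})"

definition dist_max :: "('m::metric_space \<times> 'b::metric_space) \<Rightarrow> ('m \<times> 'b) \<Rightarrow> real" where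
  "dist_max p q = max (dist (fst p) (fst q)) (dist (snd p) (snd q))"

definition diam_max :: "('m::metric_space \<times> 'b::metric_space) set \<Rightarrow> ereal" where
  "diam_max U = (if U = {} then 0 else (SUP p\<in>U. SUP q\<in>U. ereal (dist_max p q)))"

definition hausdorff_max :: "(real \<Rightarrow> real) \<Rightarrow> ('m::metric_space \<times> 'b::metric_space) set \<Rightarrow> ennreal" where
  "hausdorff_max \<psi> E = (SUP \<delta>\<in>{0<..}. INF U\<in>{U :: nat \<Rightarrow> ('m \<times> 'b) set.
       E \<subseteq> (\<Union>i. U i) \<and> (\<forall>i. diam_max (U i) \<le> ereal \<delta>)}.
       (\<Sum>i. ennreal (\<psi> (real_of_ereal (diam_max (U i))))))"

end

theory Submission
  imports Defs "HOL-Computational_Algebra.Fundamental_Theorem_Algebra"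
begin

text \<open>For infinitely many n there is h in V_n (x) B with N_alpha(f - h) < r_n = rho^(1/phi(n)) and
rho < 1. Testing with bounded functionals on B gives, up to constants depending only on the scalar
field, the sup norm bound |f - h| <= r_n and, since v o h lies in V_n for every functional v, the
Lipschitz bound M_n on S for h, where M_n is the Markov constant. Hence f oscillates by O(r_n) on
balls of radius r_n / M_n. By the covering hypothesis O((M_n / r_n)^k) such balls suffice, and the
parts of the graph over them have diameter O(r_n), so that the total cost is
O(M_n^k psi(const r_n)). This is bounded by the hypothesis applied to sqrt rho, because M_n is
nondecreasing and r_n = o(sqrt(rho)^(1/phi(n))). If all M_n vanish, f is constant on S.\<close>

section \<open>Real Hahn--Banach theorem\<close>

text \<open>Bounds for B-valued functions are reduced to scalar ones by functionals that are linear
  over the scalars. As the scalars form an abstract real normed field, this takes two preparations: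
  a real Hahn-Banach theorem, and the fact that such a field is R or R + R j with j * j = -1. The
  Markov constant is a supremum of reals, so its finiteness has to be derived before monotonicity in
  n or a Lipschitz bound can be read off; it comes from the equivalence of norms on
  finite-dimensional spaces. The passage from rho to sqrt rho is forced by the form of the
  hypothesis: the cost contains psi at K r_n with a large constant K, the hypothesis controls psi at
  M_n rho^(1/phi(n)), M_n may be smaller than K, and no doubling condition on psi is assumed that
  would absorb K. The trick needs M_n bounded away from 0, which monotonicity gives once a single
  M_n is positive.\<close>

definition sublinear :: "('a::real_vector \<Rightarrow> real) \<Rightarrow> bool" where
  "sublinear p \<longleftrightarrow> (\<forall>x y. p (x + y) \<le> p x + p y) \<and> (\<forall>c x. 0 < c \<longrightarrow> p (c *\<^sub>R x) = c * p x)"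

lemma sublinear_add: "sublinear p \<Longrightarrow> p (x + y) \<le> p x + p y"
  and sublinear_scale: "sublinear p \<Longrightarrow> 0 < c \<Longrightarrow> p (c *\<^sub>R x) = c * p x"
  by (auto simp: sublinear_def)

lemma sublinear_0:
  assumes "sublinear p" shows "p 0 = 0"
  using sublinear_scale[OF assms, of 2 0] by simp

lemma sublinear_ge:
  assumes "sublinear p" shows "- p (- x) \<le> p x"
  using sublinear_add[OF assms, of x "- x"] sublinear_0[OF assms] by simp

text \<open>Serves both constructions of sublinear functionals, by lowering and by infima of chains.
  Homogeneity is assumed only as an inequality: used for c and for its inverse, it yields
  equality.\<close>

lemma sublinear_INF:
  fixes g :: "'i \<Rightarrow> 'a::real_vector \<Rightarrow> real"
  assumes ne: "I \<noteq> {}"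
    and bdd: "\<And>x. bdd_below ((\<lambda>i. g i x) ` I)"
    and add: "\<And>i j x y. i \<in> I \<Longrightarrow> j \<in> I \<Longrightarrow> \<exists>l\<in>I. g l (x + y) \<le> g i x + g j y"
    and scale: "\<And>i c x. i \<in> I \<Longrightarrow> 0 < c \<Longrightarrow> \<exists>l\<in>I. g l (c *\<^sub>R x) \<le> c * g i x"
  shows "sublinear (\<lambda>x. INF i\<in>I. g i x)" (is "sublinear ?u")
proof -
  have lower: "?u x \<le> g i x" if "i \<in> I" for i x
    using bdd that by (rule cINF_lower)
  have "?u (x + y) \<le> ?u x + ?u y" for x y
  proof -
    have 1: "?u (x + y) - g j y \<le> g i x" if "i \<in> I" "j \<in> I" for i j
      using add[OF that, of x y] lower[of _ "x + y"] by fastforce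
    have "?u (x + y) - g j y \<le> ?u x" if "j \<in> I" for j
      using ne 1 that by (intro cINF_greatest) auto
    then have "?u (x + y) - ?u x \<le> ?u y"
      using ne by (intro cINF_greatest) (auto simp: algebra_simps)
    then show ?thesis by simp
  qed
  moreover have le: "?u (c *\<^sub>R x) \<le> c * ?u x" if c: "0 < c" for c x
  proof -
    have "?u (c *\<^sub>R x) / c \<le> g i x" if "i \<in> I" for i
      using scale[OF that c, of x] lower[of _ "c *\<^sub>R x"] c
      by (fastforce simp: pos_divide_le_eq mult.commute)
    then have "?u (c *\<^sub>R x) / c \<le> ?u x"
      using ne by (intro cINF_greatest) auto
    then show ?thesis using c by (simp add: pos_divide_le_eq mult.commute)
  qed
  moreover have "?u (c *\<^sub>R x) = c * ?u x" if c: "0 < c" for c x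
  proof (rule antisym[OF le[OF c]])
    have "?u x \<le> inverse c * ?u (c *\<^sub>R x)"
      using le[of "inverse c" "c *\<^sub>R x"] c by simp
    then show "c * ?u x \<le> ?u (c *\<^sub>R x)" using c by (simp add: field_simps)
  qed
  ultimately show ?thesis unfolding sublinear_def by blast
qed

text \<open>The lowered functional is the infimum over t >= 0 of p(x + t b) - t p(b). It shows that a minimal
sublinear functional is odd, hence linear.\<close>

lemma sublinear_lowered:
  assumes p: "sublinear p"
  obtains q where "sublinear q" "\<And>x. q x \<le> p x" "q (- b) \<le> - p b"
proof -
  let ?g = "\<lambda>t x. p (x + t *\<^sub>R b) - t * p b"
  let ?q = "\<lambda>x. INF t\<in>{0..}. ?g t x"
  have p_scale: "p (t *\<^sub>R b) = t * p b" if "0 \<le> t" for t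
    using that sublinear_scale[OF p] sublinear_0[OF p] by (cases "t = 0") auto
  have "- p (- x) \<le> ?g t x" if "0 \<le> t" for t x
    using sublinear_add[OF p, of "x + t *\<^sub>R b" "- x"] p_scale[OF that] by simp
  then have bdd: "bdd_below ((\<lambda>t. ?g t x) ` {0..})" for x
    by (intro bdd_belowI2) auto
  have "sublinear ?q"
  proof (rule sublinear_INF[OF _ bdd])
    fix s t :: real and x y assume "s \<in> {0..}" "t \<in> {0..}"
    moreover have "?g (s + t) (x + y) \<le> ?g s x + ?g t y"
      using sublinear_add[OF p, of "x + s *\<^sub>R b" "y + t *\<^sub>R b"] by (simp add: algebra_simps)
    ultimately show "\<exists>l\<in>{0..}. ?g l (x + y) \<le> ?g s x + ?g t y" by force
  next
    fix t c :: real and x assume "t \<in> {0..}" "0 < c"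
    moreover from this have "?g (c * t) (c *\<^sub>R x) \<le> c * ?g t x"
      using sublinear_scale[OF p, of c "x + t *\<^sub>R b"] by (simp add: algebra_simps)
    ultimately show "\<exists>l\<in>{0..}. ?g l (c *\<^sub>R x) \<le> c * ?g t x"
      by (intro bexI[of _ "c * t"]) auto
  qed simp
  moreover have "?q x \<le> p x" for x
    using cINF_lower[OF bdd, of 0 x] by simp
  moreover have "?q (- b) \<le> - p b"
    using cINF_lower[OF bdd, of 1 "- b"] sublinear_0[OF p] by simp
  ultimately show thesis by (rule that)
qed

text \<open>Zorn's lemma for the reversed order. The infimum of a chain is finite because every
  sublinear q <= p satisfies - p (- x) <= - q (- x) <= q x.\<close>

lemma minimal_sublinear_exists:
  assumes p: "sublinear p"
  obtains u where "sublinear u" "u \<le> p" "\<And>q. sublinear q \<Longrightarrow> q \<le> u \<Longrightarrow> q = u"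
proof -
  let ?A = "{q. sublinear q \<and> q \<le> p}"
  let ?P = "\<lambda>a b :: 'a \<Rightarrow> real. b \<le> a"
  have "\<exists>m\<in>?A. \<forall>a\<in>?A. ?P m a \<longrightarrow> a = m"
  proof (rule predicate_Zorn)
    show "partial_order_on ?A (relation_of ?P ?A)"
      by (rule partial_order_on_relation_ofI) auto
  next
    fix C assume C: "C \<in> Chains (relation_of ?P ?A)"
    then have CA: "C \<subseteq> ?A" by (auto simp: Chains_def relation_of_def)
    have tot: "a \<le> b \<or> b \<le> a" if "a \<in> C" "b \<in> C" for a b
      using C that by (auto simp: Chains_def relation_of_def)
    show "\<exists>u\<in>?A. \<forall>a\<in>C. u \<le> a"
    proof (cases "C = {}")
      case True then show ?thesis using p by auto
    next
      case False
      let ?u = "\<lambda>x. INF q\<in>C. q x"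
      have "- p (- x) \<le> q x" if "q \<in> C" for q x
      proof -
        have "q (- x) \<le> p (- x)" using CA that by (auto simp: le_fun_def)
        then show ?thesis using sublinear_ge[of q x] CA that by force
      qed
      then have bdd: "bdd_below ((\<lambda>q. q x) ` C)" for x by (intro bdd_belowI2)
      have le: "?u \<le> q" if "q \<in> C" for q
        using cINF_lower[OF bdd that] by (simp add: le_fun_def)
      have "sublinear ?u"
      proof (rule sublinear_INF[OF False bdd])
        fix q r x y assume qr: "q \<in> C" "r \<in> C"
        then have sub: "sublinear q" "sublinear r" using CA by auto
        show "\<exists>l\<in>C. l (x + y) \<le> q x + r y"
        proof (cases "q \<le> r")
          case True
          then show ?thesis using qr sublinear_add[OF sub(1), of x y]
            by (intro bexI[of _ q]) (auto simp: le_fun_def intro: order_trans add_left_mono)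
        next
          case False
          then have "r \<le> q" using tot qr by blast
          then show ?thesis using qr sublinear_add[OF sub(2), of x y]
            by (intro bexI[of _ r]) (auto simp: le_fun_def intro: order_trans add_right_mono)
        qed
      next
        fix q c x assume "q \<in> C" "0 < (c::real)"
        then show "\<exists>l\<in>C. l (c *\<^sub>R x) \<le> c * q x"
          using CA sublinear_scale[of q c x] by (intro bexI[of _ q]) auto
      qed
      moreover have "?u \<le> p" using False le CA by (blast intro: order_trans)
      ultimately show ?thesis using le by blast
    qed
  qed
  then show thesis using that by (auto intro: order_trans)
qed

text \<open>The norm is lowered at b before Zorn's lemma is applied: then q (- b) <= - norm b, so
  every odd u below q has u b >= norm b. A minimal u is odd because lowering it in any direction
  cannot change it.\<close>

lemma Hahn_Banach_norming:
  fixes b :: "'a::real_normed_vector"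
  obtains u :: "'a \<Rightarrow> real" where "linear u" "\<And>x. \<bar>u x\<bar> \<le> norm x" "u b = norm b"
proof -
  have "sublinear (norm :: 'a \<Rightarrow> real)"
    by (auto simp: sublinear_def norm_triangle_ineq)
  then obtain q :: "'a \<Rightarrow> real"
    where q: "sublinear q" "\<And>x. q x \<le> norm x" "q (- b) \<le> - norm b"
    using sublinear_lowered by blast
  obtain u where u: "sublinear u" "u \<le> q" and min: "\<And>r. sublinear r \<Longrightarrow> r \<le> u \<Longrightarrow> r = u"
    using minimal_sublinear_exists[OF q(1)] by blast
  have odd: "u (- x) = - u x" for x
  proof -
    obtain r where "sublinear r" "\<And>y. r y \<le> u y" and r: "r (- x) \<le> - u x"
      using sublinear_lowered[OF u(1)] by blast
    then have "r = u" using min by (simp add: le_fun_def)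
    then show ?thesis using r sublinear_ge[OF u(1), of "- x"] by simp
  qed
  have "u (x + y) = u x + u y" for x y
    using sublinear_add[OF u(1), of x y] sublinear_add[OF u(1), of "- x" "- y"] odd[of x] odd[of y]
      odd[of "x + y"] by simp
  moreover have "u (c *\<^sub>R x) = c * u x" for c x
  proof (cases c "0 :: real" rule: linorder_cases)
    case less
    then show ?thesis using sublinear_scale[OF u(1), of "- c" x] odd[of "c *\<^sub>R x"] by simp
  qed (use sublinear_scale[OF u(1)] sublinear_0[OF u(1)] in auto)
  ultimately have "linear u" by (intro linearI) auto
  moreover have le: "u x \<le> norm x" for x
    using u(2) q(2) by (meson le_fun_def order_trans)
  moreover have "\<bar>u x\<bar> \<le> norm x" for x
    using le[of x] le[of "- x"] odd[of x] by simp
  moreover have "u b = norm b"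
  proof (rule antisym[OF le])
    have "u (- b) \<le> q (- b)" using u(2) by (simp add: le_fun_def)
    then show "norm b \<le> u b" using q(3) odd[of b] by linarith
  qed
  ultimately show thesis using that by blast
qed

section \<open>Real normed fields\<close>

text \<open>The field may lack i, so a complex polynomial p1 + i p2 is evaluated at x as the pair of
  p1(x) and p2(x), with \<open>im_eval\<close> for the second entry.\<close>

definition re_eval :: "'f::real_normed_field \<Rightarrow> complex poly \<Rightarrow> 'f" where
  "re_eval x p = poly (map_poly (\<lambda>c. of_real (Re c)) p) x"

definition im_eval :: "'f::real_normed_field \<Rightarrow> complex poly \<Rightarrow> 'f" where
  "im_eval x p = poly (map_poly (\<lambda>c. of_real (Im c)) p) x"

text \<open>The value at x of the real polynomial (X - z)(X - conj z).\<close>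

definition real_quadratic :: "'f::real_normed_field \<Rightarrow> complex \<Rightarrow> 'f" where
  "real_quadratic x z = (x - of_real (Re z))^2 + of_real (Im z)^2"

lemma re_im_eval_linear_mult:
  "re_eval x ([:- z, 1:] * q) = (x - of_real (Re z)) * re_eval x q + of_real (Im z) * im_eval x q"
  "im_eval x ([:- z, 1:] * q) = (x - of_real (Re z)) * im_eval x q - of_real (Im z) * re_eval x q"
proof -
  have "map_poly (\<lambda>c. of_real (Re c)) ([:- z, 1:] * q) =
      pCons 0 (map_poly (\<lambda>c. of_real (Re c)) q) - smult (of_real (Re z)) (map_poly (\<lambda>c. of_real (Re c)) q)
      + smult (of_real (Im z)) (map_poly (\<lambda>c. of_real (Im c) :: 'a) q)"
    by (rule poly_eqI) (simp add: coeff_map_poly coeff_pCons split: nat.split)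
  from arg_cong[OF this, of "\<lambda>p. poly p x"] show "re_eval x ([:- z, 1:] * q) = (x - of_real (Re z)) * re_eval x q + of_real (Im z) * im_eval x q"
    unfolding re_eval_def im_eval_def by (simp add: left_diff_distrib del: mult_pCons_left)
  have "map_poly (\<lambda>c. of_real (Im c)) ([:- z, 1:] * q) =
      pCons 0 (map_poly (\<lambda>c. of_real (Im c)) q) - smult (of_real (Re z)) (map_poly (\<lambda>c. of_real (Im c)) q)
      - smult (of_real (Im z)) (map_poly (\<lambda>c. of_real (Re c) :: 'a) q)"
    by (rule poly_eqI) (simp add: coeff_map_poly coeff_pCons split: nat.split)
  from arg_cong[OF this, of "\<lambda>p. poly p x"] show "im_eval x ([:- z, 1:] * q) = (x - of_real (Re z)) * im_eval x q - of_real (Im z) * re_eval x q"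
    unfolding re_eval_def im_eval_def by (simp add: left_diff_distrib del: mult_pCons_left)
qed

text \<open>With i adjoined formally to the field, the form below is the norm of p(x), which is multiplicative.\<close>

lemma norm_form_linear_mult:
  "re_eval x ([:- z, 1:] * q)^2 + im_eval x ([:- z, 1:] * q)^2 =
     real_quadratic x z * (re_eval x q^2 + im_eval x q^2)"
  unfolding re_im_eval_linear_mult real_quadratic_def by algebra

text \<open>Over the complex numbers p splits into linear factors. By
  \<open>norm_form_linear_mult\<close> each of them contributes a factor
  \<open>real_quadratic x z\<close> of norm at least m, and the remaining constant is the leading
  coefficient.\<close>

lemma norm_form_ge:
  assumes m: "0 \<le> m" "\<And>z. m \<le> norm (real_quadratic x z)"
  shows "(norm (lead_coeff p))^2 * m ^ degree p \<le> norm (re_eval x p^2 + im_eval x p^2)"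
proof (induction "degree p" arbitrary: p)
  case 0
  then obtain c where c: "p = [:c:]" by (metis degree_eq_zeroE)
  have "re_eval x p^2 + im_eval x p^2 = of_real ((norm c)^2)"
    by (simp add: c re_eval_def im_eval_def map_poly_pCons cmod_power2 del: of_real_power)
      (simp flip: of_real_power of_real_add)
  then show ?case by (simp add: c norm_power)
next
  case (Suc d)
  then have "\<not> constant (poly p)" by (simp add: constant_degree)
  then obtain z where "poly p z = 0" using fundamental_theorem_of_algebra by blast
  then obtain q where q: "p = [:- z, 1:] * q" by (metis dvdE poly_eq_0_iff_dvd)
  then have "q \<noteq> 0" using Suc.hyps(2) by auto
  then have deg: "degree p = Suc (degree q)" unfolding q by (subst degree_mult_eq) auto
  have "lead_coeff p = lead_coeff q" unfolding q lead_coeff_mult by simp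
  then have "(norm (lead_coeff p))^2 * m ^ degree p = m * ((norm (lead_coeff q))^2 * m ^ degree q)"
    by (simp add: deg)
  also have "\<dots> \<le> norm (real_quadratic x z) * norm (re_eval x q^2 + im_eval x q^2)"
    using Suc.hyps deg m by (intro mult_mono) auto
  also have "\<dots> = norm (re_eval x p^2 + im_eval x p^2)"
    unfolding q norm_form_linear_mult norm_mult ..
  finally show ?case .
qed

text \<open>The norm tends to infinity with z, so its minimisers form a nonempty compact set. Taking
  one of greatest modulus gives the strict inequality that \<open>real_quadratic_root\<close>
  contradicts.\<close>

lemma real_quadratic_min:
  fixes x :: "'f::real_normed_field"
  obtains z0 where "\<And>z. norm (real_quadratic x z0) \<le> norm (real_quadratic x z)"
    "\<And>z. norm z0 < norm z \<Longrightarrow> norm (real_quadratic x z0) < norm (real_quadratic x z)"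
proof -
  define g where "g = (\<lambda>z. norm (real_quadratic x z))"
  define r where "r = norm x + 1"
  have r: "norm x \<le> r" "1 \<le> r" by (auto simp: r_def)
  have cont: "continuous_on UNIV g"
    unfolding g_def real_quadratic_def by (intro continuous_intros)
  have g0: "g 0 \<le> r^2"
    using r by (auto simp: g_def real_quadratic_def norm_power intro: power_mono)
  \<comment> \<open>Outside this ball |z| (|z| - 2 r) > 8 r^2, while |z|^2 <= g z + 2 |z| r + r^2.
    Hence g z > 7 r^2, which exceeds the bound r^2 for g 0.\<close>
  have big: "r^2 < g z" if "4 * r < norm z" for z
  proof -
    have eq: "of_real ((norm z)^2) = real_quadratic x z + (of_real (2 * Re z) * x - x^2)"
      unfolding real_quadratic_def cmod_power2 by (simp add: power2_eq_square algebra_simps)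
    have "(norm z)^2 = norm (of_real ((norm z)^2) :: 'f)" by (simp add: norm_power)
    also have "\<dots> \<le> g z + norm (of_real (2 * Re z) * x - x^2)"
      unfolding eq g_def by (rule norm_triangle_ineq)
    also have "norm (of_real (2 * Re z) * x - x^2) \<le> norm (of_real (2 * Re z) * x) + norm (x^2)"
      by (rule norm_triangle_ineq4)
    also have "norm (of_real (2 * Re z) * x) = 2 * (\<bar>Re z\<bar> * norm x)"
      by (simp add: norm_mult abs_mult)
    also have "\<bar>Re z\<bar> * norm x \<le> norm z * r"
      using r abs_Re_le_cmod by (intro mult_mono) auto
    also have "norm (x^2) \<le> r^2" using r by (simp add: norm_power power_mono)
    finally have 1: "(norm z)^2 \<le> g z + (2 * (norm z * r) + r^2)" by simp
    have "(4 * r) * (2 * r) < norm z * (norm z - 2 * r)"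
      using that r by (intro mult_strict_mono) auto
    then have "2 * (norm z * r) + 8 * r^2 < (norm z)^2"
      by (simp add: algebra_simps power2_eq_square)
    moreover have "0 < r^2" using r by simp
    ultimately show ?thesis using 1 by linarith
  qed
  obtain w where w: "w \<in> cball 0 (4 * r)" "\<And>z. z \<in> cball 0 (4 * r) \<Longrightarrow> g w \<le> g z"
    using continuous_attains_inf[OF compact_cball[of 0 "4 * r"] _ continuous_on_subset[OF cont]] r
    by auto
  have min: "g w \<le> g z" for z
  proof (cases "4 * r < norm z")
    case True
    then show ?thesis using w(2)[of 0] big[OF True] g0 r by auto
  qed (use w(2)[of z] in auto)
  define Z where "Z = {z. g z = g w}"
  have "Z \<subseteq> cball 0 (4 * r)"
  proof
    fix z assume "z \<in> Z"
    then have "g z \<le> r^2" using min[of 0] g0 by (simp add: Z_def)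
    then show "z \<in> cball 0 (4 * r)" using big[of z] by fastforce
  qed
  moreover have "closed Z"
    unfolding Z_def by (intro closed_Collect_eq cont continuous_on_const)
  ultimately have "compact Z"
    by (meson bounded_cball bounded_subset compact_eq_bounded_closed)
  moreover have "w \<in> Z" by (simp add: Z_def)
  ultimately obtain z0 where z0: "z0 \<in> Z" "\<And>z. z \<in> Z \<Longrightarrow> norm z \<le> norm z0"
    using continuous_attains_sup[of Z norm] by (auto intro: continuous_intros)
  show thesis
  proof
    show "norm (real_quadratic x z0) \<le> norm (real_quadratic x z)" for z
      using min z0(1) by (simp add: Z_def g_def)
    show "norm (real_quadratic x z0) < norm (real_quadratic x z)" if "norm z0 < norm z" for z
      using min[of z] z0(1) z0(2)[of z] that by (fastforce simp: Z_def g_def)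
  qed
qed

section \<open>Evaluation of real polynomials and Tornheim's argument\<close>

lemma poly_map_of_real_const:
  "poly (map_poly of_real [:c:]) (y :: 'a::{real_algebra_1,idom}) = of_real c"
  by (simp add: map_poly_pCons)

lemma poly_map_of_real_add:
  "poly (map_poly of_real (p + q)) (y :: 'a::{real_algebra_1,idom})
     = poly (map_poly of_real p) y + poly (map_poly of_real q) y"
proof -
  have "map_poly of_real (p + q) = map_poly of_real p + (map_poly of_real q :: 'a poly)"
    by (rule poly_eqI) (simp add: coeff_map_poly)
  then show ?thesis by simp
qed

lemma poly_map_of_real_mult:
  "poly (map_poly of_real (p * q)) (y :: 'a::{real_algebra_1,idom})
     = poly (map_poly of_real p) y * poly (map_poly of_real q) y"
proof (induction p)
  case (pCons a p)
  have "map_poly of_real (smult a q) = smult (of_real a) (map_poly of_real q :: 'a poly)"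
    by (rule poly_eqI) (simp add: coeff_map_poly)
  then show ?case
    by (simp add: poly_map_of_real_add map_poly_pCons pCons.IH algebra_simps)
qed simp

lemma poly_map_of_real_power:
  "poly (map_poly of_real (p ^ n)) (y :: 'a::{real_algebra_1,idom}) = poly (map_poly of_real p) y ^ n"
  by (induction n) (simp_all add: poly_map_of_real_mult)

lemma poly_map_of_real_quadratic:
  "poly (map_poly of_real [:s^2 + t^2, - 2 * s, 1:]) (y :: 'a::{real_algebra_1,idom})
     = (y - of_real s)^2 + of_real t^2"
  by (simp add: map_poly_pCons power2_eq_square algebra_simps)

text \<open>Tornheim's argument. If q is the real quadratic of a minimiser z0, then q^n - (-e)^n has a root z1
with |z1| > |z0|; estimating all its other linear factors by the minimum m bounds the value at z1.
For e < m and n tending to infinity this value is at most m, so z1 is also a minimiser.\<close>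

lemma real_quadratic_root_bound:
  fixes x :: "'f::real_normed_field" and z0 :: complex and n :: nat
  defines "m \<equiv> norm (real_quadratic x z0)"
  assumes min: "\<And>z. m \<le> norm (real_quadratic x z)" and m: "0 < m" and e: "0 < e" and n: "0 < n"
  shows "norm (real_quadratic x (Complex (Re z0) (sqrt ((Im z0)^2 + e)))) * m ^ (2 * n - 1)
    \<le> (m ^ n + e ^ n)^2"
proof -
  let ?z = "Complex (Re z0) (sqrt ((Im z0)^2 + e))"
  define q0 :: "real poly" where "q0 = [:(Re z0)^2 + (Im z0)^2, - 2 * Re z0, 1:]"
  \<comment> \<open>This is q0^n - (-e)^n. At \<open>?z\<close> the quadratic q0 takes the value -
    ((Im z0)^2 + e) + (Im z0)^2 = -e, so \<open>?z\<close> is a root.\<close>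
  define G where "G = q0 ^ n + [:- ((- e) ^ n):]"
  define P :: "complex poly" where "P = map_poly of_real G"
  have q0: "degree q0 = 2" "lead_coeff q0 = 1" "q0 \<noteq> 0" by (auto simp: q0_def)
  have degn: "degree (q0 ^ n) = 2 * n" using q0 by (simp add: degree_power_eq)
  have deg: "degree G = 2 * n"
    unfolding G_def by (subst degree_add_eq_left) (use degn n in auto)
  have "lead_coeff G = 1"
  proof -
    have "lead_coeff G = lead_coeff (q0 ^ n)"
      unfolding deg unfolding G_def using n degn by (simp add: coeff_pCons split: nat.split)
    then show ?thesis using q0 by (simp add: lead_coeff_power)
  qed
  then have P: "degree P = 2 * n" "lead_coeff P = 1"
    using deg by (auto simp: P_def degree_map_poly coeff_map_poly)
  note eval = poly_map_of_real_add[of "q0 ^ n" "[:- ((- e) ^ n):]", folded G_def]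
      poly_map_of_real_power poly_map_of_real_const
  note q0_eval = poly_map_of_real_quadratic[of "Re z0" "Im z0", folded q0_def]
  have "poly P ?z = 0"
  proof -
    have "(?z - of_real (Re z0))^2 = - of_real ((Im z0)^2 + e)"
      using e by (auto simp: complex_eq_iff power2_eq_square)
    then show ?thesis by (simp add: P_def eval q0_eval)
  qed
  then obtain Q where Q: "P = [:- ?z, 1:] * Q" by (metis dvdE poly_eq_0_iff_dvd)
  have "Q \<noteq> 0" using P Q by auto
  then have "degree P = Suc (degree Q)" unfolding Q by (subst degree_mult_eq) auto
  then have dQ: "degree Q = 2 * n - 1" using P by simp
  have lQ: "lead_coeff Q = 1" using P(2) unfolding Q lead_coeff_mult by simp
  have "re_eval x P = poly (map_poly of_real G) x"
    unfolding re_eval_def P_def by (subst map_poly_map_poly) (auto simp: o_def)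
  then have re: "re_eval x P = real_quadratic x z0 ^ n - of_real ((- e) ^ n)"
    by (simp add: eval q0_eval real_quadratic_def)
  \<comment> \<open>P has real coefficients, so the norm form at P is just the square of
    \<open>re_eval x P\<close>; this is the origin of the square in the bound.\<close>
  have im: "im_eval x P = 0"
  proof -
    have "map_poly (\<lambda>c. of_real (Im c)) P = (0 :: 'f poly)"
      by (rule poly_eqI) (simp add: P_def coeff_map_poly)
    then show ?thesis by (simp add: im_eval_def)
  qed
  have "norm (real_quadratic x ?z) * m ^ (2 * n - 1)
      \<le> norm (real_quadratic x ?z) * norm (re_eval x Q^2 + im_eval x Q^2)"
  proof (rule mult_left_mono)
    show "m ^ (2 * n - 1) \<le> norm (re_eval x Q^2 + im_eval x Q^2)"
      using norm_form_ge[OF less_imp_le[OF m] min, of Q] unfolding lQ unfolding dQ by simp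
  qed simp
  also have "\<dots> = norm (re_eval x P)^2"
    unfolding norm_mult[symmetric] norm_form_linear_mult[symmetric] Q[symmetric] im
    by (simp add: norm_power)
  also have "norm (re_eval x P)^2 \<le> (m ^ n + e ^ n)^2"
  proof (rule power_mono)
    show "norm (re_eval x P) \<le> m ^ n + e ^ n"
      unfolding re using norm_triangle_ineq4[of "real_quadratic x z0 ^ n" "of_real ((- e) ^ n)"] e
      by (simp add: m_def norm_power)
  qed simp
  finally show ?thesis .
qed

text \<open>If the minimum m were positive, e = m / 2 would turn the previous bound into w <= m (1 +
  2^(-n))^2 for all n >= 1, hence w <= m at a point of greater modulus than z0. The choice of z0
  excludes this.\<close>

lemma real_quadratic_root:
  fixes x :: "'f::real_normed_field"
  obtains z where "real_quadratic x z = 0"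
proof -
  obtain z0 where z0: "\<And>z. norm (real_quadratic x z0) \<le> norm (real_quadratic x z)"
    "\<And>z. norm z0 < norm z \<Longrightarrow> norm (real_quadratic x z0) < norm (real_quadratic x z)"
    using real_quadratic_min[of x] by blast
  define m where "m = norm (real_quadratic x z0)"
  have "m = 0"
  proof (rule ccontr)
    assume "m \<noteq> 0"
    then have m: "0 < m" by (simp add: m_def)
    define e where "e = m / 2"
    define z where "z = Complex (Re z0) (sqrt ((Im z0)^2 + e))"
    define w where "w = norm (real_quadratic x z)"
    have "norm z0 < norm z" using m by (simp add: z_def e_def cmod_def)
    then have "m < w" using z0(2) by (simp add: m_def w_def)
    moreover have "w \<le> m"
    proof (rule LIMSEQ_le_const)
      have "(\<lambda>n. m * (1 + (1 / 2) ^ n)^2) \<longlonglongrightarrow> m * (1 + 0)^2"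
        by (intro tendsto_intros LIMSEQ_realpow_zero) auto
      then show "(\<lambda>n. m * (1 + (1 / 2) ^ n)^2) \<longlonglongrightarrow> m" by simp
      have "w \<le> m * (1 + (1 / 2) ^ n)^2" if "1 \<le> n" for n
      proof -
        have "w * m ^ (2 * n - 1) \<le> (m ^ n + e ^ n)^2"
          using real_quadratic_root_bound[of x z0 e n] z0(1) m that
          unfolding w_def z_def m_def e_def by auto
        also have "\<dots> = (m * (1 + (1 / 2) ^ n)^2) * m ^ (2 * n - 1)"
        proof -
          have "m ^ n + e ^ n = m ^ n * (1 + (1 / 2) ^ n)"
            by (simp add: e_def power_divide distrib_left)
          then have "(m ^ n + e ^ n)^2 = m ^ (2 * n) * (1 + (1 / 2) ^ n)^2"
            by (simp only: power_mult_distrib power_even_eq)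
          moreover have "m ^ (2 * n) = m * m ^ (2 * n - 1)"
            using that power_Suc[of m "2 * n - 1"] by simp
          ultimately show ?thesis by (simp only: mult_ac)
        qed
        finally show ?thesis using m by simp
      qed
      then show "\<exists>N. \<forall>n\<ge>N. w \<le> m * (1 + (1 / 2) ^ n)^2" by blast
    qed
    ultimately show False by simp
  qed
  then show thesis using that by (simp add: m_def)
qed

text \<open>If x is not real and (x - s)^2 + t^2 = 0, then t is nonzero and j = (x - s) / t squares
  to -1. The quadratic of any other c then splits over R + R j. The value j = 0 encodes the real
  case, so that one decomposition serves both.\<close>

lemma real_normed_field_cases:
  obtains j :: "'f::real_normed_field" where "j = 0 \<or> j * j = - 1"
    "\<And>c. \<exists>s t. c = of_real s + of_real t * j"
proof (cases "\<forall>c :: 'f. \<exists>s. c = of_real s")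
  case True
  then show thesis using that[of 0] by auto
next
  case False
  then obtain x :: 'f where x: "\<And>s. x \<noteq> of_real s" by blast
  obtain z where z: "(x - of_real (Re z))^2 + of_real (Im z)^2 = 0"
    using real_quadratic_root[of x] by (auto simp: real_quadratic_def)
  then have Im: "Im z \<noteq> 0" using x[of "Re z"] by auto
  define j where "j = (x - of_real (Re z)) / of_real (Im z)"
  have jj: "j * j = - 1"
    using z Im by (simp add: j_def power2_eq_square divide_simps eq_neg_iff_add_eq_0)
  moreover have "\<exists>s t. c = of_real s + of_real t * j" for c
  proof -
    obtain y where y: "(c - of_real (Re y))^2 + of_real (Im y)^2 = 0"
      using real_quadratic_root[of c] by (auto simp: real_quadratic_def)
    have "(c - of_real (Re y) - of_real (Im y) * j) * (c - of_real (Re y) + of_real (Im y) * j) = 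
       (c - of_real (Re y))^2 - of_real (Im y)^2 * (j * j)"
      by (simp add: power2_eq_square algebra_simps)
    also have "\<dots> = 0" using y by (simp add: jj)
    finally have "c - of_real (Re y) - of_real (Im y) * j = 0 \<or> c - of_real (Re y) + of_real (Im y) * j = 0"
      by (simp only: mult_eq_0_iff)
    then have "c = of_real (Re y) + of_real (Im y) * j \<or> c = of_real (Re y) + of_real (- Im y) * j"
      by (auto simp: algebra_simps)
    then show ?thesis by blast
  qed
  ultimately show thesis using that by blast
qed

text \<open>The field is R or R + R j, so the usual passage u(x) - j u(j x) from real to F-linear functionals
works. No relation between the norms of s + t j and s - t j is available, which costs the factors 2.\<close>

lemma F_module_norming_functional:
  fixes fsc :: "'f::real_normed_field \<Rightarrow> 'b::banach \<Rightarrow> 'b"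
  assumes "F_module fsc"
  obtains v where "bdd_functional_B fsc v 2" "norm b \<le> 2 * norm (v b)"
proof -
  have add: "fsc c (x + y) = fsc c x + fsc c y" and add': "fsc (c + d) x = fsc c x + fsc d x"
    and mult: "fsc (c * d) x = fsc c (fsc d x)" and one: "fsc 1 x = x"
    and real: "fsc (of_real r) x = r *\<^sub>R x" and norm: "norm (fsc c x) = norm c * norm x"
    for c d x y r
    using assms by (auto simp: F_module_def)
  obtain j :: 'f where j: "j = 0 \<or> j * j = - 1" and decomp: "\<And>c. \<exists>s t. c = of_real s + of_real t * j"
    using real_normed_field_cases by blast
  have nj: "norm j \<le> 1"
  proof (cases "j = 0")
    case False
    then have "norm (j * j) = 1" using j by simp
    then have "(norm j)^2 = 1^2" by (simp add: norm_mult power2_eq_square)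
    then have "norm j = 1" by (rule power2_eq_imp_eq) auto
    then show ?thesis by simp
  qed simp
  obtain u where u: "linear u" "\<And>x. \<bar>u x\<bar> \<le> norm x" "u b = norm b"
    using Hahn_Banach_norming[of b] by blast
  define v where "v = (\<lambda>x. of_real (u x) - j * of_real (u (fsc j x)))"
  have v_add: "v (x + y) = v x + v y" for x y
    by (simp add: v_def add linear_add[OF u(1)] algebra_simps)
  have v_real: "v (r *\<^sub>R x) = of_real r * v x" for r x
  proof -
    have "fsc j (r *\<^sub>R x) = r *\<^sub>R fsc j x"
      unfolding real[symmetric] mult[symmetric] by (simp add: mult.commute)
    then show ?thesis by (simp add: v_def linear_scale[OF u(1)] algebra_simps)
  qed
  have v_j: "v (fsc j x) = j * v x" for x
  proof (cases "j = 0")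
    case True
    then show ?thesis using real[of 0 x] linear_0[OF u(1)] by (simp add: v_def)
  next
    case False
    then have jj: "j * j = - 1" using j by blast
    have "fsc j (fsc j x) = - x"
      using real[of "- 1" x] unfolding mult[symmetric] jj by simp
    then have "v (fsc j x) = of_real (u (fsc j x)) + j * of_real (u x)"
      by (simp add: v_def linear_neg[OF u(1)])
    also have "\<dots> = j * of_real (u x) - (j * j) * of_real (u (fsc j x))" by (simp add: jj)
    finally show ?thesis by (simp add: v_def algebra_simps)
  qed
  have "v (fsc d x) = d * v x" for d x
  proof -
    obtain s t where d: "d = of_real s + of_real t * j" using decomp by blast
    have "fsc d x = s *\<^sub>R x + t *\<^sub>R fsc j x" by (simp add: d add' mult real)
    then show ?thesis by (simp add: v_add v_real v_j d algebra_simps)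
  qed
  moreover have "norm (v x) \<le> 2 * norm x" for x
  proof -
    have "norm (v x) \<le> \<bar>u x\<bar> + norm j * \<bar>u (fsc j x)\<bar>"
      unfolding v_def by (rule order_trans[OF norm_triangle_ineq4]) (simp add: norm_mult)
    also have "norm j * \<bar>u (fsc j x)\<bar> \<le> 1 * norm (fsc j x)"
      using nj u(2) by (intro mult_mono) auto
    also have "norm (fsc j x) \<le> 1 * norm x"
      unfolding norm using nj by (intro mult_right_mono) auto
    finally show ?thesis using u(2)[of x] by simp
  qed
  moreover have "norm b \<le> 2 * norm (v b)"
  proof (cases "j = 0 \<or> b = 0")
    case True
    then show ?thesis using u(3) by (auto simp: v_def)
  next
    case False
    then have jj: "j * j = - 1" using j by blast
    \<comment> \<open>Multiplying v b = |b| - j t by its conjugate gives |b|^2 + t^2 <= |v b| S.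
      Since S^2 <= 2 (|b|^2 + t^2), this yields |b| <= S <= 2 |v b|.\<close>
    define t where "t = u (fsc j b)"
    define S where "S = norm b + \<bar>t\<bar>"
    have S: "0 < S" using False by (simp add: S_def add_pos_nonneg)
    have v: "v b = of_real (norm b) - j * of_real t" by (simp add: v_def u(3) t_def)
    have "v b * (of_real (norm b) + j * of_real t) = of_real ((norm b)^2) - (j * j) * of_real (t^2)"
      by (simp add: v power2_eq_square algebra_simps)
    also have "\<dots> = of_real ((norm b)^2 + t^2)" by (simp add: jj)
    finally have "norm (v b) * norm (of_real (norm b) + j * of_real t) = norm (of_real ((norm b)^2 + t^2) :: 'f)"
      by (simp flip: norm_mult)
    also have "\<dots> = (norm b)^2 + t^2" unfolding norm_of_real by simp
    finally have "(norm b)^2 + t^2 = norm (v b) * norm (of_real (norm b) + j * of_real t)" by simp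
    also have "norm (of_real (norm b) + j * of_real t) \<le> norm b + norm j * \<bar>t\<bar>"
      by (rule order_trans[OF norm_triangle_ineq]) (simp add: norm_mult)
    also have "norm j * \<bar>t\<bar> \<le> 1 * \<bar>t\<bar>" using nj by (intro mult_right_mono) auto
    finally have le: "(norm b)^2 + t^2 \<le> norm (v b) * S"
      by (simp add: S_def mult_left_mono)
    have "0 \<le> (norm b - \<bar>t\<bar>)^2" by simp
    then have "S * S \<le> 2 * ((norm b)^2 + t^2)"
      by (simp add: S_def power2_eq_square algebra_simps)
    then have "S * S \<le> (2 * norm (v b)) * S" using le by simp
    then have "S \<le> 2 * norm (v b)" using S by simp
    then show ?thesis by (simp add: S_def)
  qed
  ultimately show thesis using v_add that unfolding bdd_functional_B_def by blast
qed

section \<open>Markov constants\<close>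

text \<open>The two claims need each other in the induction: closedness of the old span keeps a new
  b at a distance d > 0 from it, which bounds the coefficient of b; this bound makes the
  coefficients along a convergent sequence Cauchy, so that the new span is closed. B may be
  dependent, hence the coefficients are only claimed to exist.\<close>

lemma finite_span_coefficient_bound:
  fixes B :: "'a::real_normed_vector set"
  assumes "finite B"
  shows "closed (span B) \<and>
    (\<exists>K\<ge>0. \<forall>x\<in>span B. \<exists>c. x = (\<Sum>b\<in>B. c b *\<^sub>R b) \<and> (\<forall>b\<in>B. \<bar>c b\<bar> \<le> K * norm x))"
  using assms
proof (induction B rule: finite_induct)
  case empty
  then show ?case by auto
next
  case (insert b B)
  then obtain K where closed: "closed (span B)" and K: "0 \<le> K"
    and coeff: "\<And>x. x \<in> span B \<Longrightarrow> \<exists>c. x = (\<Sum>b\<in>B. c b *\<^sub>R b) \<and> (\<forall>b\<in>B. \<bar>c b\<bar> \<le> K * norm x)"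
    by blast
  show ?case
  proof (cases "b \<in> span B")
    case True
    then have span: "span (insert b B) = span B" by (rule span_redundant)
    have "\<exists>c. x = (\<Sum>a\<in>insert b B. c a *\<^sub>R a) \<and> (\<forall>a\<in>insert b B. \<bar>c a\<bar> \<le> K * norm x)"
      if x: "x \<in> span B" for x
    proof -
      obtain c where c: "x = (\<Sum>b\<in>B. c b *\<^sub>R b)" "\<And>b. b \<in> B \<Longrightarrow> \<bar>c b\<bar> \<le> K * norm x"
        using coeff[OF x] by blast
      have "(\<Sum>a\<in>insert b B. (c(b := 0)) a *\<^sub>R a) = (\<Sum>a\<in>B. (c(b := 0)) a *\<^sub>R a)"
        using insert.hyps by simp
      also have "\<dots> = x" unfolding c(1) using insert.hyps by (intro sum.cong) auto
      finally show ?thesis using c(2) K by (intro exI[of _ "c(b := 0)"]) auto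
    qed
    then show ?thesis using closed K unfolding span by blast
  next
    case False
    then obtain d where d: "0 < d" "ball b d \<subseteq> - span B"
      using closed openE[of "- span B" b] by (auto simp: open_Compl)
    have dist: "\<bar>a\<bar> * d \<le> norm (y + a *\<^sub>R b)" if y: "y \<in> span B" for y a
    proof (cases "a = 0")
      case False
      have "(- inverse a) *\<^sub>R y \<in> span B" using y by (rule span_scale)
      then have "(- inverse a) *\<^sub>R y \<notin> ball b d" using d by blast
      then have "d \<le> norm (b - (- inverse a) *\<^sub>R y)" by (simp add: dist_norm)
      then have "\<bar>a\<bar> * d \<le> norm (a *\<^sub>R (b - (- inverse a) *\<^sub>R y))" by (simp add: mult_left_mono)
      also have "a *\<^sub>R (b - (- inverse a) *\<^sub>R y) = y + a *\<^sub>R b"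
        using False by (simp add: algebra_simps)
      finally show ?thesis .
    qed simp
    have decomp: "\<exists>y a. y \<in> span B \<and> x = y + a *\<^sub>R b" if "x \<in> span (insert b B)" for x
      using that unfolding span_breakdown_eq by (metis diff_add_cancel)
    have "closed (span (insert b B))"
      unfolding closed_sequential_limits
    proof (intro allI impI, elim conjE)
      fix f l assume f: "\<forall>n. f n \<in> span (insert b B)" and lim: "f \<longlonglongrightarrow> l"
      have "\<forall>n. \<exists>y a. y \<in> span B \<and> f n = y + a *\<^sub>R b"
        using f decomp by blast
      then obtain y where "\<forall>n. \<exists>a. y n \<in> span B \<and> f n = y n + a *\<^sub>R b"
        by (rule choice[THEN exE])
      then obtain a where "\<forall>n. y n \<in> span B \<and> f n = y n + a n *\<^sub>R b"
        by (rule choice[THEN exE])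
      then have y: "y n \<in> span B" and eq: "f n = y n + a n *\<^sub>R b" for n
        by auto
      have "Cauchy a"
      proof (rule CauchyI)
        fix e :: real assume "0 < e"
        then obtain N where N: "\<And>m n. m \<ge> N \<Longrightarrow> n \<ge> N \<Longrightarrow> norm (f m - f n) < e * d"
          using LIMSEQ_imp_Cauchy[OF lim] d CauchyD[of f "e * d"] by auto
        have "norm (a m - a n) < e" if "m \<ge> N" "n \<ge> N" for m n
        proof -
          have "\<bar>a m - a n\<bar> * d \<le> norm (y m - y n + (a m - a n) *\<^sub>R b)"
            using y by (intro dist span_diff)
          also have "\<dots> = norm (f m - f n)" by (simp add: eq algebra_simps)
          also have "\<dots> < e * d" by (rule N[OF that])
          finally show ?thesis using d by simp
        qed
        then show "\<exists>N. \<forall>m\<ge>N. \<forall>n\<ge>N. norm (a m - a n) < e" by blast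
      qed
      then obtain a0 where "a \<longlonglongrightarrow> a0" using Cauchy_convergent_iff convergent_def by blast
      then have "(\<lambda>n. f n - a n *\<^sub>R b) \<longlonglongrightarrow> l - a0 *\<^sub>R b"
        using lim by (intro tendsto_intros)
      then have "y \<longlonglongrightarrow> l - a0 *\<^sub>R b" by (simp add: eq)
      then have "l - a0 *\<^sub>R b \<in> span B"
        using closed y unfolding closed_sequential_limits by blast
      then show "l \<in> span (insert b B)" unfolding span_breakdown_eq by blast
    qed
    moreover
    \<comment> \<open>The coefficient a of b satisfies |a| <= |x| / d, and the remainder y in the
      old span has norm at most (1 + norm b / d) |x|. The two entries bound the new and the old
      coefficients.\<close>
    define K' where "K' = max (1 / d) (K * (1 + norm b / d))"
    have "0 \<le> K'" using d by (simp add: K'_def le_max_iff_disj)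
    moreover have "\<exists>c. x = (\<Sum>a\<in>insert b B. c a *\<^sub>R a) \<and> (\<forall>a\<in>insert b B. \<bar>c a\<bar> \<le> K' * norm x)"
      if x: "x \<in> span (insert b B)" for x
    proof -
      obtain y a where y: "y \<in> span B" and xy: "x = y + a *\<^sub>R b" using decomp[OF x] by blast
      have a: "\<bar>a\<bar> \<le> norm x / d" using dist[OF y, of a] d by (simp add: xy field_simps)
      have "norm y = norm (x - a *\<^sub>R b)" by (simp add: xy)
      also have "\<dots> \<le> norm x + \<bar>a\<bar> * norm b"
        by (rule order_trans[OF norm_triangle_ineq4]) simp
      also have "\<bar>a\<bar> * norm b \<le> norm x / d * norm b" using a by (intro mult_right_mono) auto
      finally have ny: "norm y \<le> (1 + norm b / d) * norm x" by (simp add: algebra_simps)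
      obtain c where c: "y = (\<Sum>b\<in>B. c b *\<^sub>R b)" "\<And>b. b \<in> B \<Longrightarrow> \<bar>c b\<bar> \<le> K * norm y"
        using coeff[OF y] by blast
      have "(\<Sum>a'\<in>B. (c(b := a)) a' *\<^sub>R a') = y"
        unfolding c(1) using insert.hyps by (intro sum.cong) auto
      then have "x = (\<Sum>a'\<in>insert b B. (c(b := a)) a' *\<^sub>R a')"
        using insert.hyps by (simp add: xy)
      moreover have "\<bar>(c(b := a)) a'\<bar> \<le> K' * norm x" if a': "a' \<in> insert b B" for a'
      proof (cases "a' = b")
        case True
        have "1 / d * norm x \<le> K' * norm x" by (intro mult_right_mono) (auto simp: K'_def)
        then show ?thesis using a True by simp
      next
        case False
        then have "\<bar>(c(b := a)) a'\<bar> \<le> K * norm y" using c(2) a' by auto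
        also have "\<dots> \<le> K * ((1 + norm b / d) * norm x)" using ny K by (rule mult_left_mono)
        also have "\<dots> \<le> K' * norm x"
          unfolding mult.assoc[symmetric] by (intro mult_right_mono) (auto simp: K'_def)
        finally show ?thesis .
      qed
      ultimately show ?thesis by blast
    qed
    ultimately show ?thesis by blast
  qed
qed

text \<open>Functions of sup norm at most 1 have bounded coefficients with respect to finitely many
  generators, each of which is Lipschitz. Compactness of the domain places all of them in the normed
  space of bounded continuous functions, where the coefficient bound applies.\<close>

lemma fin_dim_fun_equi_Lipschitz:
  fixes W :: "('m::metric_space \<Rightarrow> 'f::real_normed_field) set"
  assumes cpt: "compact (UNIV :: 'm set)" and fin: "fin_dim_fun W"
    and lip: "\<And>f. f \<in> W \<Longrightarrow> \<exists>L. L-lipschitz_on UNIV f"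
  obtains K where "\<And>f x y. f \<in> W \<Longrightarrow> (\<And>m. norm (f m) \<le> 1) \<Longrightarrow> norm (f x - f y) \<le> K * dist x y"
proof -
  obtain G where G: "finite G" "G \<subseteq> W" "fun_span G = W" using fin by (auto simp: fin_dim_fun_def)
  obtain j :: 'f where decomp: "\<And>c. \<exists>s t. c = of_real s + of_real t * j"
    using real_normed_field_cases by blast
  \<comment> \<open>The coefficient bound concerns real spans; adding the multiples j g makes the
    real span contain the span of G over the field.\<close>
  define H where "H = G \<union> (\<lambda>g m. j * g m) ` G"
  have H_lip: "\<exists>L. L-lipschitz_on UNIV h" if "h \<in> H" for h
    using that unfolding H_def
  proof
    assume "h \<in> (\<lambda>g m. j * g m) ` G"
    then obtain g where g: "g \<in> G" "h = (\<lambda>m. j * g m)" by blast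
    then obtain L where "L-lipschitz_on UNIV g" using lip G(2) by blast
    then have "(norm j * L)-lipschitz_on UNIV h"
      unfolding g(2) lipschitz_on_def
      by (auto simp: dist_norm norm_mult mult.assoc mult_left_mono simp flip: right_diff_distrib)
    then show ?thesis by blast
  qed (use lip G(2) in blast)
  have H_bc: "h \<in> bcontfun" if "h \<in> H" for h
  proof -
    have "continuous_on UNIV h" using H_lip[OF that] lipschitz_on_continuous_on by blast
    moreover from this have "bounded (range h)"
      using cpt compact_continuous_image compact_imp_bounded by blast
    ultimately show ?thesis by (simp add: bcontfun_def)
  qed
  define B where "B = Bcontfun ` H"
  have "finite B" using G(1) by (simp add: B_def H_def)
  have in_B: "\<exists>b\<in>span B. apply_bcontfun b = h" if "h \<in> H" for h
    using that H_bc[OF that] by (intro bexI[of _ "Bcontfun h"] span_base) (auto simp: B_def Bcontfun_inverse)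
  have span_W: "\<exists>b\<in>span B. \<forall>m. apply_bcontfun b m = (\<Sum>i<n. c i * g i m)"
    if "\<forall>i<n. g i \<in> G" for n :: nat and c g
    using that
  proof (induction n)
    case 0
    show ?case by (intro bexI[of _ 0] span_zero) simp
  next
    case (Suc n)
    then obtain b where b: "b \<in> span B" "\<And>m. apply_bcontfun b m = (\<Sum>i<n. c i * g i m)" by auto
    obtain s t where c: "c n = of_real s + of_real t * j" using decomp by blast
    have "g n \<in> H" "(\<lambda>m. j * g n m) \<in> H" using Suc.prems by (auto simp: H_def)
    then obtain p q where p: "p \<in> span B" "apply_bcontfun p = g n"
      and q: "q \<in> span B" "apply_bcontfun q = (\<lambda>m. j * g n m)"
      using in_B by meson
    have "b + (s *\<^sub>R p + t *\<^sub>R q) \<in> span B"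
      using b(1) p(1) q(1) by (intro span_add span_scale)
    moreover have "apply_bcontfun (b + (s *\<^sub>R p + t *\<^sub>R q)) m = (\<Sum>i<Suc n. c i * g i m)" for m
      by (simp add: b(2) p(2) q(2) c scaleR_conv_of_real algebra_simps)
    ultimately show ?case by blast
  qed
  obtain K where K: "0 \<le> K"
    "\<And>x. x \<in> span B \<Longrightarrow> \<exists>c. x = (\<Sum>b\<in>B. c b *\<^sub>R b) \<and> (\<forall>b\<in>B. \<bar>c b\<bar> \<le> K * norm x)"
    using finite_span_coefficient_bound[OF \<open>finite B\<close>] by blast
  have "\<exists>L\<ge>0. \<forall>x y. norm (apply_bcontfun b x - apply_bcontfun b y) \<le> L * dist x y" if b: "b \<in> B" for b
  proof -
    obtain h where h: "h \<in> H" "b = Bcontfun h" using b by (auto simp: B_def)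
    obtain L where "L-lipschitz_on UNIV h" using H_lip[OF h(1)] by blast
    then show ?thesis
      using H_bc[OF h(1)] by (auto simp: h(2) Bcontfun_inverse lipschitz_on_def dist_norm)
  qed
  then obtain L where L: "\<And>b. b \<in> B \<Longrightarrow> 0 \<le> L b"
    "\<And>b x y. b \<in> B \<Longrightarrow> norm (apply_bcontfun b x - apply_bcontfun b y) \<le> L b * dist x y"
    by metis
  show thesis
  proof (rule that)
    fix f x y assume f: "f \<in> W" and bnd: "\<And>m. norm (f m) \<le> 1"
    obtain n c g where "f = (\<lambda>m. \<Sum>i<n. c i * g i m)" "\<forall>i<(n::nat). g i \<in> G"
      using f unfolding G(3)[symmetric] fun_span_def by blast
    then obtain b where b: "b \<in> span B" "apply_bcontfun b = f"
      using span_W[of n g c] by fastforce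
    then obtain c where c: "b = (\<Sum>a\<in>B. c a *\<^sub>R a)" "\<And>a. a \<in> B \<Longrightarrow> \<bar>c a\<bar> \<le> K * norm b"
      using K(2) by blast
    have "norm b \<le> 1" by (rule norm_bound) (simp add: b(2) bnd)
    then have "K * norm b \<le> K" using K(1) mult_left_mono[of "norm b" 1 K] by simp
    then have c': "\<bar>c a\<bar> \<le> K" if "a \<in> B" for a using c(2)[OF that] by linarith
    have apply_sum: "apply_bcontfun (\<Sum>a\<in>A. c a *\<^sub>R a) z = (\<Sum>a\<in>A. c a *\<^sub>R apply_bcontfun a z)" for A z
      by (induction A rule: infinite_finite_induct) auto
    have "f x - f y = (\<Sum>a\<in>B. c a *\<^sub>R (apply_bcontfun a x - apply_bcontfun a y))"
      unfolding b(2)[symmetric] c(1) apply_sum by (simp add: scaleR_diff_right sum_subtractf)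
    then have "norm (f x - f y) \<le> (\<Sum>a\<in>B. norm (c a *\<^sub>R (apply_bcontfun a x - apply_bcontfun a y)))"
      using norm_sum by metis
    also have "\<dots> \<le> (\<Sum>a\<in>B. K * (L a * dist x y))"
      unfolding norm_scaleR using c' L K(1) by (intro sum_mono mult_mono) auto
    also have "\<dots> = (\<Sum>a\<in>B. K * L a) * dist x y" by (simp add: sum_distrib_right mult.assoc)
    finally show "norm (f x - f y) \<le> (\<Sum>a\<in>B. K * L a) * dist x y" .
  qed
qed

abbreviation markov_quotients :: "('m::metric_space \<Rightarrow> 'f::real_normed_field) set \<Rightarrow> 'm set \<Rightarrow> real set" where
  "markov_quotients W S \<equiv> insert 0 {norm (f x - f y) / dist x y | f x y.
     f \<in> W \<and> (\<forall>m. norm (f m) \<le> 1) \<and> x \<in> S \<and> y \<in> S \<and> x \<noteq> y}"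

text \<open>The real \<open>Sup\<close> of an unbounded set carries no information, so each later
  property of \<open>markov_const\<close> takes this bound as a hypothesis.\<close>

lemma markov_quotients_bdd_above:
  fixes W :: "('m::metric_space \<Rightarrow> 'f::real_normed_field) set"
  assumes "compact (UNIV :: 'm set)" "fin_dim_fun W" "\<And>f. f \<in> W \<Longrightarrow> \<exists>L. L-lipschitz_on UNIV f"
  shows "bdd_above (markov_quotients W S)"
proof -
  obtain K where K: "\<And>f x y. f \<in> W \<Longrightarrow> (\<And>m. norm (f m) \<le> 1) \<Longrightarrow> norm (f x - f y) \<le> K * dist x y"
    using fin_dim_fun_equi_Lipschitz[OF assms] by blast
  have "norm (f x - f y) / dist x y \<le> K"
    if "f \<in> W" "\<forall>m. norm (f m) \<le> 1" "x \<noteq> y" for f x y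
    using K[of f x y] that by (simp add: pos_divide_le_eq)
  then show ?thesis by (intro bdd_aboveI[of _ "max 0 K"]) (auto simp: le_max_iff_disj)
qed

lemma approx_setting_markov_bdd_above:
  assumes "approx_setting A NA V" shows "bdd_above (markov_quotients (V n) S)"
proof (rule markov_quotients_bdd_above)
  show "\<exists>L. L-lipschitz_on UNIV f" if "f \<in> V n" for f
    using assms that unfolding approx_setting_def by blast
qed (use assms in \<open>auto simp: approx_setting_def\<close>)

lemma markov_const_nonneg:
  "bdd_above (markov_quotients W S) \<Longrightarrow> 0 \<le> markov_const W S"
  unfolding markov_const_def by (intro cSup_upper) auto

lemma markov_const_mono:
  "bdd_above (markov_quotients W' S) \<Longrightarrow> W \<subseteq> W' \<Longrightarrow> markov_const W S \<le> markov_const W' S"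
  unfolding markov_const_def by (intro cSup_subset_mono) blast+

lemma markov_const_Lipschitz:
  fixes W :: "('m::metric_space \<Rightarrow> 'f::real_normed_field) set"
  assumes bdd: "bdd_above (markov_quotients W S)" and W: "fun_subspace (*) W"
    and f: "f \<in> W" "\<And>m. norm (f m) \<le> R" and R: "0 < R" and xy: "x \<in> S" "y \<in> S"
  shows "norm (f x - f y) \<le> R * (markov_const W S * dist x y)"
proof (cases "x = y")
  case False
  define g where "g = (\<lambda>m. of_real (inverse R) * f m)"
  have g: "g \<in> W" using W f(1) by (auto simp: g_def fun_subspace_def)
  have norm_g: "norm (g m) \<le> 1" for m
  proof -
    have "norm (g m) = norm (f m) / R"
      using R by (simp add: g_def norm_mult norm_inverse divide_inverse mult.commute del: of_real_inverse)
    then show ?thesis using f(2)[of m] R by simp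
  qed
  have "norm (g x - g y) / dist x y \<le> markov_const W S"
    unfolding markov_const_def using g norm_g xy False by (intro cSup_upper[OF _ bdd]) blast
  then have "norm (g x - g y) \<le> markov_const W S * dist x y"
    using False by (simp add: pos_divide_le_eq)
  moreover have "of_real R * g z = f z" for z
    using R by (simp add: g_def flip: mult.assoc of_real_mult del: of_real_inverse)
  then have "f x - f y = of_real R * (g x - g y)" by (simp add: right_diff_distrib)
  ultimately show ?thesis using R by (simp add: norm_mult)
qed simp

section \<open>Lipschitz and sup norm bounds for tensors\<close>

lemma fun_subspace_sum:
  fixes g :: "nat \<Rightarrow> 'm \<Rightarrow> 'v::real_normed_vector"
  assumes "fun_subspace sc W" "\<forall>i<n. g i \<in> W"
  shows "(\<lambda>m. \<Sum>i<n. sc (c i) (g i m)) \<in> W"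
  using assms(2)
proof (induction n)
  case (Suc n)
  then show ?case using assms(1) by (auto simp: fun_subspace_def)
qed (use assms(1) in \<open>auto simp: fun_subspace_def\<close>)

lemma bdd_functional_B_sum:
  assumes "bdd_functional_B fsc v c"
  shows "v (\<Sum>i<(n::nat). fsc (a i) (b i)) = (\<Sum>i<n. a i * v (b i))"
proof -
  have v: "v (x + y) = v x + v y" "v (fsc d x) = d * v x" for x y d
    using assms by (auto simp: bdd_functional_B_def)
  have "v 0 = 0" using v(1)[of 0 0] by simp
  then show ?thesis by (induction n) (auto simp: v)
qed

text \<open>The factor 4 is 2 * 2: the functional v chosen for h x - h y recovers its norm up to a
  factor 2, and the scalar function v o h is bounded by 2 R.\<close>

lemma tens_Lipschitz:
  assumes F: "F_module fsc" and W: "fun_subspace (*) W"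
    and bdd: "bdd_above (markov_quotients W S)"
    and h: "h \<in> tens fsc W" "\<And>m. norm (h m) \<le> R" and R: "0 < R" and xy: "x \<in> S" "y \<in> S"
  shows "norm (h x - h y) \<le> 4 * R * (markov_const W S * dist x y)"
proof -
  obtain v where v: "bdd_functional_B fsc v 2" and b: "norm (h x - h y) \<le> 2 * norm (v (h x - h y))"
    using F_module_norming_functional[OF F] by blast
  have v_add: "v (p + q) = v p + v q" and v_norm: "norm (v p) \<le> 2 * norm p" for p q
    using v by (auto simp: bdd_functional_B_def)
  have v_diff: "v (p - q) = v p - v q" for p q using v_add[of "p - q" q] by simp
  obtain n a b where "h = (\<lambda>m. \<Sum>i<(n::nat). fsc (a i m) (b i))" and a: "\<forall>i<n. a i \<in> W"
    using h(1) by (auto simp: tens_def)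
  then have vh: "(\<lambda>m. v (h m)) = (\<lambda>m. \<Sum>i<n. v (b i) * a i m)"
    by (simp add: bdd_functional_B_sum[OF v] mult.commute)
  have vhW: "(\<lambda>m. v (h m)) \<in> W"
    unfolding vh using fun_subspace_sum[OF W a, of "\<lambda>i. v (b i)"] .
  have "norm (v (h m)) \<le> 2 * R" for m
    using v_norm[of "h m"] h(2)[of m] by linarith
  then have "norm (v (h x) - v (h y)) \<le> 2 * R * (markov_const W S * dist x y)"
    using markov_const_Lipschitz[OF bdd W vhW _ _ xy, of "2 * R"] R by simp
  then show ?thesis using b by (simp add: v_diff)
qed

text \<open>Dual crossnorm bound for evaluation at m, of norm at most 1 since \<open>NA\<close>
  dominates the sup norm, paired with the functional v chosen for u m, of norm at most 2. Norming
  costs the other factor 2.\<close>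

lemma Nalpha_dominates_on_tens:
  assumes F: "F_module fsc" and A: "approx_setting A NA V"
    and T: "tensor_completion fsc A NA X Nalpha" and u: "u \<in> tens fsc A"
  shows "norm (u m) \<le> 4 * Nalpha u"
proof -
  obtain v where v: "bdd_functional_B fsc v 2" and b: "norm (u m) \<le> 2 * norm (v (u m))"
    using F_module_norming_functional[OF F] by blast
  obtain n a b where u: "u = (\<lambda>m. \<Sum>i<(n::nat). fsc (a i m) (b i))" and a: "\<forall>i<n. a i \<in> A"
    using u by (auto simp: tens_def)
  have "bdd_functional_A A NA (\<lambda>g. g m) 1"
    using A by (auto simp: bdd_functional_A_def approx_setting_def)
  then have "norm (\<Sum>i<n. a i m * v (b i)) \<le> 1 * 2 * Nalpha u"
    using T v a unfolding tensor_completion_def u by blast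
  also have "(\<Sum>i<n. a i m * v (b i)) = v (u m)"
    by (simp add: u bdd_functional_B_sum[OF v])
  finally show ?thesis using b by simp
qed

lemma fun_subspace_diff:
  assumes F: "F_module fsc" and W: "fun_subspace fsc W" and "x \<in> W" "y \<in> W"
  shows "(\<lambda>m. x m - y m) \<in> W"
proof -
  have "fsc (- 1) p = - p" for p
    using F unfolding F_module_def by (metis of_real_1 of_real_minus scaleR_minus1_left)
  moreover have "(\<lambda>m. fsc (- 1) (y m)) \<in> W"
    using W assms(4) unfolding fun_subspace_def by simp
  then have "(\<lambda>m. x m + fsc (- 1) (y m)) \<in> W"
    using W assms(3) unfolding fun_subspace_def by simp
  ultimately show ?thesis by simp
qed

text \<open>Approximating tensors converge to x both in \<open>Nalpha\<close> and pointwise, so the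
  bound for tensors passes to the limit.\<close>

lemma Nalpha_dominates:
  assumes F: "F_module fsc" and A: "approx_setting A NA V"
    and T: "tensor_completion fsc A NA X Nalpha" and x: "x \<in> X"
  shows "norm (x m) \<le> 4 * Nalpha x"
proof -
  have sub: "fun_subspace fsc X" and tX: "tens fsc A \<subseteq> X" and nrm: "fun_norm_on fsc X Nalpha"
    and dense: "fun_dense (tens fsc A) X Nalpha"
    and pointwise: "\<And>u. (\<forall>k. u k \<in> tens fsc A) \<and> (\<lambda>k. Nalpha (\<lambda>m. u k m - x m)) \<longlonglongrightarrow> 0 \<Longrightarrow>
        (\<lambda>k. u k m) \<longlonglongrightarrow> x m"
    using T x by (auto simp: tensor_completion_def)
  \<comment> \<open>Density supplies small x - u, whereas pointwise convergence is stated for u -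
    x.\<close>
  have neg: "Nalpha (\<lambda>m. q m - p m) = Nalpha (\<lambda>m. p m - q m)" if "p \<in> X" "q \<in> X" for p q
  proof -
    have "fsc (- 1) p = - p" for p
      using F unfolding F_module_def by (metis of_real_1 of_real_minus scaleR_minus1_left)
    then have "(\<lambda>m. q m - p m) = (\<lambda>m. fsc (- 1) (p m - q m))" by simp
    then show ?thesis
      using nrm fun_subspace_diff[OF F sub that] unfolding fun_norm_on_def by simp
  qed
  have "\<exists>d\<in>tens fsc A. Nalpha (\<lambda>m. x m - d m) < inverse (real (Suc k))" for k
    using dense x unfolding fun_dense_def by auto
  then obtain u where u: "\<And>k. u k \<in> tens fsc A" "\<And>k. Nalpha (\<lambda>m. x m - u k m) < inverse (real (Suc k))"
    by metis
  have uX: "u k \<in> X" for k using u(1) tX by blast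
  have diffX: "(\<lambda>m. u k m - x m) \<in> X" for k by (rule fun_subspace_diff[OF F sub uX x])
  have lim: "(\<lambda>k. Nalpha (\<lambda>m. u k m - x m)) \<longlonglongrightarrow> 0"
  proof (rule tendsto_sandwich[OF _ _ tendsto_const LIMSEQ_inverse_real_of_nat])
    show "\<forall>\<^sub>F k in sequentially. 0 \<le> Nalpha (\<lambda>m. u k m - x m)"
      using nrm diffX unfolding fun_norm_on_def by auto
    show "\<forall>\<^sub>F k in sequentially. Nalpha (\<lambda>m. u k m - x m) \<le> inverse (real (Suc k))"
      using u(2) unfolding neg[OF x uX] by (intro always_eventually allI less_imp_le)
  qed
  have "norm (u k m) \<le> 4 * (Nalpha x + Nalpha (\<lambda>m. u k m - x m))" for k
  proof -
    have "Nalpha (\<lambda>m. x m + (u k m - x m)) \<le> Nalpha x + Nalpha (\<lambda>m. u k m - x m)"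
      using bspec[OF bspec[OF conjunct1[OF conjunct2[OF nrm[unfolded fun_norm_on_def]]] x] diffX] .
    then show ?thesis using Nalpha_dominates_on_tens[OF F A T u(1), of k m] by simp
  qed
  moreover have "(\<lambda>k. norm (u k m)) \<longlonglongrightarrow> norm (x m)"
    using pointwise u(1) lim by (intro tendsto_norm) blast
  moreover have "(\<lambda>k. 4 * (Nalpha x + Nalpha (\<lambda>m. u k m - x m))) \<longlonglongrightarrow> 4 * (Nalpha x + 0)"
    using lim by (intro tendsto_intros)
  ultimately show ?thesis using LIMSEQ_le by fastforce
qed

section \<open>Hausdorff measure of graphs\<close>

lemma hausdorff_max_leI:
  fixes E :: "('m::metric_space \<times> 'b::metric_space) set"
  assumes "\<And>\<delta>. 0 < \<delta> \<Longrightarrow> \<exists>U :: nat \<Rightarrow> ('m \<times> 'b) set. E \<subseteq> (\<Union>i. U i) \<and> (\<forall>i. diam_max (U i) \<le> ereal \<delta>) \<and>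
      (\<Sum>i. ennreal (\<psi> (real_of_ereal (diam_max (U i))))) \<le> c"
  shows "hausdorff_max \<psi> E \<le> c"
  unfolding hausdorff_max_def
proof (rule SUP_least)
  fix \<delta> :: real assume "\<delta> \<in> {0<..}"
  then obtain U :: "nat \<Rightarrow> ('m \<times> 'b) set" where U: "E \<subseteq> (\<Union>i. U i)" "\<forall>i. diam_max (U i) \<le> ereal \<delta>"
    "(\<Sum>i. ennreal (\<psi> (real_of_ereal (diam_max (U i))))) \<le> c"
    using assms[of \<delta>] by auto
  then show "(INF U\<in>{U :: nat \<Rightarrow> ('m \<times> 'b) set. E \<subseteq> (\<Union>i. U i) \<and> (\<forall>i. diam_max (U i) \<le> ereal \<delta>)}.
       (\<Sum>i. ennreal (\<psi> (real_of_ereal (diam_max (U i)))))) \<le> c"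
    by (intro INF_lower2[of U]) auto
qed

lemma diam_max_le:
  assumes "\<And>p q. p \<in> U \<Longrightarrow> q \<in> U \<Longrightarrow> dist_max p q \<le> D" "0 \<le> D"
  shows "diam_max U \<le> ereal D"
  using assms by (auto simp: diam_max_def intro!: SUP_least)

lemma diam_max_nonneg: "0 \<le> diam_max U"
proof (cases "U = {}")
  case False
  then obtain p where "p \<in> U" by blast
  then have "ereal (dist_max p p) \<le> (SUP q\<in>U. ereal (dist_max p q))"
    by (rule SUP_upper)
  also have "\<dots> \<le> diam_max U"
    using SUP_upper[OF \<open>p \<in> U\<close>, of "\<lambda>p. SUP q\<in>U. ereal (dist_max p q)"] False
    by (simp add: diam_max_def)
  finally have "ereal (dist_max p p) \<le> diam_max U" .
  then show ?thesis by (simp add: dist_max_def zero_ereal_def)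
qed (simp add: diam_max_def)

text \<open>Compactness provides some finite cover with centers in S, so the \<open>LEAST\<close> in
  \<open>cov_num\<close> is attained.\<close>

lemma cov_num_cover:
  assumes "compact S" "0 < e"
  obtains T where "T \<subseteq> S" "finite T" "card T = cov_num S e" "S \<subseteq> (\<Union>t\<in>T. ball t e)"
proof -
  have "S \<subseteq> (\<Union>t\<in>S. ball t e)" using assms(2) by auto
  then obtain T where "T \<subseteq> S" "finite T" "S \<subseteq> (\<Union>t\<in>T. ball t e)"
    by (rule compactE_image[OF assms(1) open_ball])
  then have "\<exists>n T. T \<subseteq> S \<and> finite T \<and> card T = n \<and> S \<subseteq> (\<Union>t\<in>T. ball t e)" by blast
  from LeastI_ex[OF this, folded cov_num_def] show thesis
    by (elim exE conjE) (rule that)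
qed

text \<open>The pieces are the parts of the graph over the balls of a minimal cover. Two points of
  one ball are less than 2 e apart, so \<open>osc\<close> is needed only at this scale, and D bounds
  both components of the max metric.\<close>

lemma graph_cover:
  fixes f :: "'m::metric_space \<Rightarrow> 'b::metric_space" and g :: "real \<Rightarrow> real"
  assumes S: "compact S" and e: "0 < e" "2 * e \<le> D"
    and osc: "\<And>x y. x \<in> S \<Longrightarrow> y \<in> S \<Longrightarrow> dist x y < 2 * e \<Longrightarrow> dist (f x) (f y) \<le> D"
    and g: "mono_on {0..} g" "g 0 = 0"
  shows "\<exists>U :: nat \<Rightarrow> ('m \<times> 'b) set. (\<lambda>s. (s, f s)) ` S \<subseteq> (\<Union>i. U i) \<and> (\<forall>i. diam_max (U i) \<le> ereal D) \<and>
      (\<Sum>i. ennreal (g (real_of_ereal (diam_max (U i))))) \<le> ennreal (real (cov_num S e) * g D)"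
proof -
  obtain T where "T \<subseteq> S" and T: "finite T" "card T = cov_num S e" "S \<subseteq> (\<Union>t\<in>T. ball t e)"
    by (rule cov_num_cover[OF S e(1)])
  define N where "N = cov_num S e"
  obtain h where "bij_betw h {0..<card T} T" using ex_bij_betw_nat_finite[OF T(1)] by blast
  then have h: "h ` {..<N} = T" by (simp add: N_def T(2) bij_betw_def lessThan_atLeast0)
  define U where "U i = (if i < N then (\<lambda>s. (s, f s)) ` (S \<inter> ball (h i) e) else {})" for i
  have D: "0 \<le> D" using e by simp
  have cover: "(\<lambda>s. (s, f s)) ` S \<subseteq> (\<Union>i. U i)"
  proof
    fix p assume "p \<in> (\<lambda>s. (s, f s)) ` S"
    then obtain s where s: "s \<in> S" "p = (s, f s)" by blast
    then obtain t where "t \<in> T" "s \<in> ball t e" using T(3) by blast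
    then obtain i where "i < N" "s \<in> ball (h i) e" unfolding h[symmetric] by blast
    then show "p \<in> (\<Union>i. U i)" using s by (auto simp: U_def)
  qed
  have diam: "diam_max (U i) \<le> ereal D" for i
  proof (rule diam_max_le[OF _ D])
    fix p q assume "p \<in> U i" "q \<in> U i"
    then obtain x y where xy: "x \<in> S" "y \<in> S" "dist (h i) x < e" "dist (h i) y < e"
      "p = (x, f x)" "q = (y, f y)" by (auto simp: U_def split: if_splits)
    then have "dist x y < 2 * e" using dist_triangle3[of x y "h i"] by simp
    then show "dist_max p q \<le> D" using osc xy e by (force simp: dist_max_def)
  qed
  have "(\<Sum>i. ennreal (g (real_of_ereal (diam_max (U i))))) = (\<Sum>i<N. ennreal (g (real_of_ereal (diam_max (U i)))))"
    using g(2) by (intro suminf_finite) (auto simp: U_def diam_max_def)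
  also have "\<dots> \<le> (\<Sum>i<N. ennreal (g D))"
  proof (intro sum_mono ennreal_leI monotone_onD[OF g(1)])
    fix i
    show "real_of_ereal (diam_max (U i)) \<le> D"
      using diam[of i] D by (cases "diam_max (U i)") auto
  qed (use diam_max_nonneg D in \<open>auto intro: real_of_ereal_pos\<close>)
  also have "\<dots> = ennreal (real N * g D)"
    using monotone_onD[OF g(1), of 0 D] g(2) D
    by (simp add: ennreal_mult ennreal_of_nat_eq_real_of_nat)
  finally show ?thesis using cover diam unfolding N_def by blast
qed

section \<open>From approximation rates to oscillation\<close>

lemma scale_function_inverse: 
  assumes "scale_function \<phi>" shows "filterlim (\<lambda>n. 1 / \<phi> n) at_top sequentially"
proof -
  have "filterlim (\<lambda>n. inverse (\<phi> n)) at_top sequentially"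
    using assms unfolding scale_function_def
    by (intro filterlim_inverse_at_top) auto
  then show ?thesis by (simp add: inverse_eq_divide)
qed

lemma powr_at_top_tendsto_0:
  fixes \<rho> :: real
  assumes "0 < \<rho>" "\<rho> < 1" "filterlim a at_top F"
  shows "((\<lambda>n. \<rho> powr a n) \<longlongrightarrow> 0) F"
proof -
  have "filterlim (\<lambda>n. ln \<rho> * a n) at_bot F"
    using assms by (intro filterlim_tendsto_neg_mult_at_bot[OF tendsto_const]) auto
  then have "((\<lambda>n. exp (ln \<rho> * a n)) \<longlongrightarrow> 0) F"
    by (rule filterlim_compose[OF exp_at_bot])
  then show ?thesis using assms(1) by (simp add: powr_def mult.commute)
qed

text \<open>The gap between the lower limit and 1 leaves room for a rho independent of n. Infinitely
  many n are enough later, because each delta requires only one good cover.\<close>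

lemma approx_class_frequently:
  assumes "f \<in> approx_class \<phi> fsc X Nalpha V" and \<phi>: "\<And>n. 0 < \<phi> n"
  obtains \<rho> where "0 < \<rho>" "\<rho> < 1"
    "\<exists>\<^sub>F n in sequentially. approx_err fsc Nalpha V n f < \<rho> powr (1 / \<phi> n)"
proof -
  let ?E = "\<lambda>n. approx_err fsc Nalpha V n f"
  let ?L = "Liminf sequentially (\<lambda>n. ereal (?E n powr \<phi> n))"
  have "?L < 1" using assms(1) by (simp add: approx_class_def)
  then obtain \<rho> where \<rho>: "?L < ereal \<rho>" "ereal \<rho> < 1"
    using ereal_dense2 by blast
  have "0 \<le> ?L" by (rule Liminf_bounded) (simp add: zero_ereal_def)
  then have pos: "0 < \<rho>" using \<rho>(1) by (metis ereal_less(2) order_le_less_trans)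
  have "\<exists>\<^sub>F n in sequentially. ?E n powr \<phi> n < \<rho>"
  proof (rule ccontr)
    assume "\<not> (\<exists>\<^sub>F n in sequentially. ?E n powr \<phi> n < \<rho>)"
    then have "\<forall>\<^sub>F n in sequentially. ereal \<rho> \<le> ereal (?E n powr \<phi> n)"
      by (simp add: not_frequently not_less)
    then have "ereal \<rho> \<le> ?L" by (rule Liminf_bounded)
    then show False using \<rho>(1) by simp
  qed
  then have "\<exists>\<^sub>F n in sequentially. ?E n < \<rho> powr (1 / \<phi> n)"
  proof (rule frequently_mono[rotated], intro allI impI)
    fix n assume n: "?E n powr \<phi> n < \<rho>"
    show "?E n < \<rho> powr (1 / \<phi> n)"
    proof (cases "0 < ?E n")
      case True
      have "(?E n powr \<phi> n) powr (1 / \<phi> n) < \<rho> powr (1 / \<phi> n)"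
        using n \<phi>[of n] by (intro powr_less_mono2) auto
      then show ?thesis using True \<phi>[of n] by (simp add: powr_powr)
    next
      \<comment> \<open>The power can be inverted only for a positive error; an error that is not
        positive lies below the positive right-hand side anyway.\<close>
      case False
      moreover have "0 < \<rho> powr (1 / \<phi> n)" using pos by simp
      ultimately show ?thesis by linarith
    qed
  qed
  then show thesis using that[OF pos] \<rho>(2) by simp
qed

text \<open>An approximant h with |f - h| <= 4 r satisfies |h| <= R + 4, because r <= 1; this enters
  its Lipschitz constant. The error 4 r is paid at both x and y.\<close>

lemma approx_err_oscillation:
  assumes F: "F_module fsc" and A: "approx_setting A NA V"
    and T: "tensor_completion fsc A NA X Nalpha" and f: "f \<in> X" "\<And>m. norm (f m) \<le> R"
    and R: "0 \<le> R" and err: "approx_err fsc Nalpha V n f < r" and r: "r \<le> 1" and xy: "x \<in> S" "y \<in> S"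
  shows "dist (f x) (f y) \<le> 4 * (R + 4) * (markov_const (V n) S * dist x y) + 8 * r"
proof -
  have V: "V n \<subseteq> A" "fun_subspace (*) (V n)" using A by (auto simp: approx_setting_def)
  have X: "fun_subspace fsc X" "tens fsc A \<subseteq> X" using T by (auto simp: tensor_completion_def)
  have "(\<lambda>m. 0) \<in> tens fsc (V n)"
    unfolding tens_def by (intro CollectI exI[of _ "0::nat"]) simp
  then have "{Nalpha (\<lambda>m. f m - h m) | h. h \<in> tens fsc (V n)} \<noteq> {}" by blast
  then obtain h where h: "h \<in> tens fsc (V n)" "Nalpha (\<lambda>m. f m - h m) < r"
    using cInf_lessD[OF _ err[unfolded approx_err_def]] by blast
  have "h \<in> tens fsc A" using h(1) V(1) unfolding tens_def by blast
  then have "(\<lambda>m. f m - h m) \<in> X" using fun_subspace_diff[OF F X(1) f(1)] X(2) by blast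
  then have fh: "norm (f m - h m) \<le> 4 * r" for m
    using Nalpha_dominates[OF F A T, of "\<lambda>m. f m - h m" m] h(2) by simp
  have "norm (h m) \<le> R + 4" for m
    using norm_triangle_sub[of "h m" "f m"] fh[of m] f(2)[of m] r by (simp add: norm_minus_commute)
  then have "norm (h x - h y) \<le> 4 * (R + 4) * (markov_const (V n) S * dist x y)"
    using R by (intro tens_Lipschitz[OF F V(2) approx_setting_markov_bdd_above[OF A] h(1) _ _ xy]) auto
  moreover have "dist (f x) (f y) \<le> norm (f x - h x) + (norm (h x - h y) + norm (f y - h y))"
    using norm_triangle_ineq[of "f x - h x" "(h x - h y) + (h y - f y)"]
      norm_triangle_ineq[of "h x - h y" "h y - f y"] by (simp add: dist_norm norm_minus_commute)
  ultimately show ?thesis using fh[of x] fh[of y] by linarith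
qed

text \<open>Needed for S of diameter 0, where no radius is admissible in the covering hypothesis and
  it says nothing.\<close>

lemma hausdorff_max_graph_subsingleton:
  fixes f :: "'m::metric_space \<Rightarrow> 'b::metric_space"
  assumes "\<And>x y. x \<in> S \<Longrightarrow> y \<in> S \<Longrightarrow> x = y" and "g 0 = 0"
  shows "hausdorff_max g ((\<lambda>s. (s, f s)) ` S) \<le> 0"
proof (rule hausdorff_max_leI)
  fix \<delta> :: real assume \<delta>: "0 < \<delta>"
  let ?E = "(\<lambda>s. (s, f s)) ` S"
  have "dist_max p q \<le> 0" if "p \<in> ?E" "q \<in> ?E" for p q
  proof -
    have "p = q" using that assms(1) by blast
    then show ?thesis by (simp add: dist_max_def)
  qed
  then have "diam_max ?E \<le> ereal 0" by (rule diam_max_le) auto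
  then have "diam_max ?E = 0" using diam_max_nonneg[of ?E] by (simp add: zero_ereal_def)
  then show "\<exists>U :: nat \<Rightarrow> ('m \<times> 'b) set. ?E \<subseteq> (\<Union>i. U i) \<and> (\<forall>i. diam_max (U i) \<le> ereal \<delta>) \<and>
      (\<Sum>i. ennreal (g (real_of_ereal (diam_max (U i))))) \<le> 0"
    using \<delta> assms(2) by (intro exI[of _ "\<lambda>_. ?E"]) auto
qed

theorem theorem2p19:
  fixes fsc :: "'f::real_normed_field \<Rightarrow> 'b::banach \<Rightarrow> 'b"
    and A :: "('m::metric_space \<Rightarrow> 'f) set" and NA :: "('m \<Rightarrow> 'f) \<Rightarrow> real"
    and V :: "nat \<Rightarrow> ('m \<Rightarrow> 'f) set"
    and X :: "('m \<Rightarrow> 'b) set" and Nalpha :: "('m \<Rightarrow> 'b) \<Rightarrow> real"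
    and S :: "'m set" and C k :: real
    and \<phi> :: "nat \<Rightarrow> real" and \<psi> :: "real \<Rightarrow> real"
    and f :: "'m \<Rightarrow> 'b"
  assumes "F_module fsc"
    and "approx_setting A NA V"
    and "tensor_completion fsc A NA X Nalpha"
    and "compact S"
    and "0 < C" and "0 < k"
    and "\<forall>\<epsilon>. 0 < \<epsilon> \<and> \<epsilon> \<le> diameter S \<longrightarrow> real (cov_num S \<epsilon>) \<le> C * \<epsilon> powr (- k)"
    and "scale_function \<phi>"
    and "continuous_on {0..} \<psi>" and "mono_on {0..} \<psi>" and "\<psi> 0 = 0"
    and "\<forall>t\<ge>0. 0 \<le> \<psi> t"
    and "\<forall>\<rho>. 0 < \<rho> \<and> \<rho> < 1 \<longrightarrow>
           limsup (\<lambda>n. ereal (markov_const (V n) S powr k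
                          * \<psi> (markov_const (V n) S * \<rho> powr (1 / \<phi> n)))) < \<infinity>"
    and "f \<in> approx_class \<phi> fsc X Nalpha V"
  shows "hausdorff_max (\<lambda>t. t powr k * \<psi> t) ((\<lambda>s. (s, f s)) ` S) < \<infinity>"
proof (cases "0 < diameter S")
  case False
  have "x = y" if "x \<in> S" "y \<in> S" for x y
    using diameter_bounded_bound[OF compact_imp_bounded[OF assms(4)] that] False
    by (smt (verit) dist_eq_0_iff zero_le_dist)
  then have "hausdorff_max (\<lambda>t. t powr k * \<psi> t) ((\<lambda>s. (s, f s)) ` S) \<le> 0"
    by (rule hausdorff_max_graph_subsingleton) simp_all
  then show ?thesis by (rule le_less_trans) simp
next
  case True
  note F = assms(1) and A = assms(2) and T = assms(3) and C = assms(5) and k = assms(6)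
  note mono = assms(10)
  let ?g = "\<lambda>t. t powr k * \<psi> t"
  let ?\<Gamma> = "(\<lambda>s. (s, f s)) ` S"
  define M where "M n = markov_const (V n) S" for n
  have \<phi>: "0 < \<phi> n" for n using assms(8) by (simp add: scale_function_def)
  obtain \<rho> where \<rho>: "0 < \<rho>" "\<rho> < 1"
    and freq: "\<exists>\<^sub>F n in sequentially. approx_err fsc Nalpha V n f < \<rho> powr (1 / \<phi> n)"
    using approx_class_frequently[OF assms(14) \<phi>] by blast
  define r where "r n = \<rho> powr (1 / \<phi> n)" for n
  have r_pos: "0 < r n" for n using \<rho> by (simp add: r_def)
  have r_le: "r n \<le> 1" for n
    using powr_mono'[of 0 "1 / \<phi> n" \<rho>] \<rho> \<phi>[of n] by (simp add: r_def)
  have r_lim: "r \<longlonglongrightarrow> 0"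
    unfolding r_def by (intro powr_at_top_tendsto_0 \<rho> scale_function_inverse assms(8))
  have fX: "f \<in> X" using assms(14) by (simp add: approx_class_def)
  then have "continuous_on UNIV f" using T by (auto simp: tensor_completion_def)
  then have "bounded (range f)"
    using A compact_continuous_image compact_imp_bounded unfolding approx_setting_def by blast
  then obtain R where R: "0 < R" "\<And>m. norm (f m) \<le> R"
    unfolding bounded_pos by auto
  have osc: "dist (f x) (f y) \<le> 4 * (R + 4) * (M n * dist x y) + 8 * r n"
    if "approx_err fsc Nalpha V n f < r n" "x \<in> S" "y \<in> S" for n x y
    unfolding M_def using R r_le that by (intro approx_err_oscillation[OF F A T fX]) auto
  note bdd = approx_setting_markov_bdd_above[OF A]
  have M_nonneg: "0 \<le> M n" for n unfolding M_def by (rule markov_const_nonneg[OF bdd])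
  have "V n \<subseteq> V (Suc n)" for n using A by (auto simp: approx_setting_def)
  then have M_mono: "M m \<le> M n" if "m \<le> n" for m n
    unfolding M_def using lift_Suc_mono_le[of V, OF _ that] by (intro markov_const_mono bdd) auto
  have g_mono: "mono_on {0..} ?g"
  proof (rule mono_onI)
    fix s t :: real assume st: "s \<in> {0..}" "t \<in> {0..}" "s \<le> t"
    then have "\<psi> s \<le> \<psi> t" by (rule mono_onD[OF mono])
    then show "s powr k * \<psi> s \<le> t powr k * \<psi> t"
      using st k assms(12) by (intro mult_mono powr_mono2) auto
  qed
  \<comment> \<open>Pieces of size D over balls of radius e cost at most C e^(-k) D^k psi(D) = C (D
    / e)^k psi(D), so only the ratio D / e and psi(D) have to be controlled.\<close>
  have cover: "\<exists>U :: nat \<Rightarrow> ('m \<times> 'b) set. ?\<Gamma> \<subseteq> (\<Union>i. U i) \<and> (\<forall>i. diam_max (U i) \<le> ereal \<delta>) \<and>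
      (\<Sum>i. ennreal (?g (real_of_ereal (diam_max (U i))))) \<le> ennreal c"
    if e: "0 < e" "e \<le> diameter S" "2 * e \<le> D" "D \<le> \<delta>"
      and D: "\<And>x y. x \<in> S \<Longrightarrow> y \<in> S \<Longrightarrow> dist x y < 2 * e \<Longrightarrow> dist (f x) (f y) \<le> D"
      and c: "C * (D / e) powr k * \<psi> D \<le> c" for e D \<delta> c
  proof -
    obtain U :: "nat \<Rightarrow> ('m \<times> 'b) set" where U: "?\<Gamma> \<subseteq> (\<Union>i. U i)" "\<And>i. diam_max (U i) \<le> ereal D"
      "(\<Sum>i. ennreal (?g (real_of_ereal (diam_max (U i))))) \<le> ennreal (real (cov_num S e) * ?g D)"
      using graph_cover[where f = f and g = ?g, OF assms(4) e(1,3) D g_mono] assms(11) by auto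
    have "0 \<le> ?g D" using assms(12) e by simp
    then have "real (cov_num S e) * ?g D \<le> C * e powr (- k) * ?g D"
      using assms(7) e by (intro mult_right_mono) auto
    also have "\<dots> = C * (D / e) powr k * \<psi> D"
    proof -
      have "(D / e) powr k = D powr k / e powr k" by (rule powr_divide)
      then show ?thesis by (simp add: powr_minus divide_inverse)
    qed
    finally have "ennreal (real (cov_num S e) * ?g D) \<le> ennreal c" using c by (intro ennreal_leI) simp
    moreover have "diam_max (U i) \<le> ereal \<delta>" for i
      using U(2)[of i] e(4) by (meson ereal_less_eq(3) order_trans)
    ultimately show ?thesis using U(1,3) by (meson order_trans)
  qed
  have "\<exists>c. hausdorff_max ?g ?\<Gamma> \<le> ennreal c"
  proof (cases "\<forall>n. M n = 0")
    case zero: True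
    have const: "dist (f x) (f y) \<le> 0" if xy: "x \<in> S" "y \<in> S" for x y
    proof (rule ccontr)
      assume "\<not> dist (f x) (f y) \<le> 0"
      then have "\<forall>\<^sub>F n in sequentially. r n < dist (f x) (f y) / 8"
        by (intro order_tendstoD(2)[OF r_lim]) auto
      from frequently_eventually_frequently[OF freq this]
      obtain n where "approx_err fsc Nalpha V n f < r n" "r n < dist (f x) (f y) / 8"
        by (auto simp: r_def dest!: frequently_ex)
      then show False using osc[of n x y] xy zero by simp
    qed
    have "hausdorff_max ?g ?\<Gamma> \<le> ennreal (C * 2 powr k * \<psi> (2 * diameter S))"
    proof (rule hausdorff_max_leI)
      fix \<delta> :: real assume \<delta>: "0 < \<delta>"
      define e where "e = min (\<delta> / 2) (diameter S)"
      have e: "0 < e" "e \<le> diameter S" "2 * e \<le> \<delta>" using \<delta> True by (auto simp: e_def)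
      have "\<psi> (2 * e) \<le> \<psi> (2 * diameter S)" using mono e by (intro mono_onD[OF mono]) auto
      then have "C * (2 * e / e) powr k * \<psi> (2 * e) \<le> C * 2 powr k * \<psi> (2 * diameter S)"
        using C e by simp
      moreover have "dist (f x) (f y) \<le> 2 * e" if "x \<in> S" "y \<in> S" for x y
        using const[OF that] e(1) by simp
      ultimately show "\<exists>U :: nat \<Rightarrow> ('m \<times> 'b) set. ?\<Gamma> \<subseteq> (\<Union>i. U i) \<and> (\<forall>i. diam_max (U i) \<le> ereal \<delta>) \<and>
          (\<Sum>i. ennreal (?g (real_of_ereal (diam_max (U i))))) \<le> ennreal (C * 2 powr k * \<psi> (2 * diameter S))"
        using e by (intro cover[of e "2 * e"]) auto
    qed
    then show ?thesis by blast
  next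
    case False
    then obtain n0 where "M n0 \<noteq> 0" by blast
    define c where "c = M n0"
    have c: "0 < c" "\<And>n. n0 \<le> n \<Longrightarrow> c \<le> M n"
      using \<open>M n0 \<noteq> 0\<close> M_nonneg[of n0] M_mono by (auto simp: c_def)
    \<comment> \<open>On balls of radius e = r_n / M_n the oscillation is at most 4 (R + 4) * 2 r_n
      + 8 r_n; the summand 2 / c secures 2 e <= K r_n, since M_n >= c.\<close>
    define K where "K = 8 * (R + 4) + 8 + 2 / c"
    have K: "0 < K" using R c by (simp add: K_def add_pos_pos)
    \<comment> \<open>As r_n is the square of r'_n, the inequality K r_n <= M_n r'_n holds as soon
      as r'_n <= c / K. This absorbs K inside psi.\<close>
    define r' where "r' n = sqrt \<rho> powr (1 / \<phi> n)" for n
    have r': "r n = r' n * r' n" for n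
      using \<rho> by (simp add: r_def r'_def flip: powr_mult)
    have r'_pos: "0 < r' n" for n using \<rho> by (simp add: r'_def)
    have r'_lim: "r' \<longlonglongrightarrow> 0"
      unfolding r'_def using \<rho> by (intro powr_at_top_tendsto_0 scale_function_inverse assms(8)) auto
    have "limsup (\<lambda>n. ereal (M n powr k * \<psi> (M n * r' n))) < \<infinity>"
      using assms(13)[rule_format, of "sqrt \<rho>"] \<rho> by (simp add: M_def r'_def)
    then obtain Q where "limsup (\<lambda>n. ereal (M n powr k * \<psi> (M n * r' n))) < ereal Q"
      using ereal_dense2 by blast
    then have Q: "\<forall>\<^sub>F n in sequentially. M n powr k * \<psi> (M n * r' n) < Q"
      by (auto dest: Limsup_lessD)
    have "hausdorff_max ?g ?\<Gamma> \<le> ennreal (C * K powr k * Q)"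
    proof (rule hausdorff_max_leI)
      fix \<delta> :: real assume \<delta>: "0 < \<delta>"
      \<comment> \<open>The three smallness conditions give, in turn, pieces of diameter at most
        delta, a radius within the range of the covering hypothesis, and the comparison of K r_n
        with M_n r'_n.\<close>
      have "\<forall>\<^sub>F n in sequentially. r n < \<delta> / K"
        by (rule order_tendstoD(2)[OF r_lim]) (use \<delta> K in simp)
      moreover have "\<forall>\<^sub>F n in sequentially. r n < c * diameter S"
        by (rule order_tendstoD(2)[OF r_lim]) (use c(1) True in simp)
      moreover have "\<forall>\<^sub>F n in sequentially. r' n < c / K"
        by (rule order_tendstoD(2)[OF r'_lim]) (use c(1) K in simp)
      moreover note Q eventually_ge_at_top[of n0]
      ultimately have "\<forall>\<^sub>F n in sequentially. r n < \<delta> / K \<and> r n < c * diameter S \<and> r' n < c / K \<and>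
          M n powr k * \<psi> (M n * r' n) < Q \<and> n0 \<le> n"
        by eventually_elim auto
      from frequently_eventually_frequently[OF freq this]
      obtain n where n: "approx_err fsc Nalpha V n f < r n" "r n < \<delta> / K" "r n < c * diameter S" "r' n < c / K"
        "M n powr k * \<psi> (M n * r' n) < Q" "n0 \<le> n"
        by (auto simp: r_def dest!: frequently_ex)
      have Mn: "c \<le> M n" "0 < M n" using c(1) c(2)[OF n(6)] by auto
      \<comment> \<open>At this radius the Lipschitz part M_n * 2 e = 2 r_n has the order of the
        approximation error. The ratio of K r_n to e is K M_n, whose k-th power produces the factor
        M_n^k of the hypothesis.\<close>
      define e where "e = r n / M n"
      have e_le: "e \<le> r n / c" unfolding e_def using Mn c r_pos[of n] by (intro divide_left_mono) auto
      have "\<psi> (K * r n) \<le> \<psi> (M n * r' n)"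
      proof (rule mono_onD[OF mono])
        have "K * r' n \<le> M n" using n(4) K Mn(1) by (simp add: field_simps)
        then have "K * r' n * r' n \<le> M n * r' n" using r'_pos[of n] by (intro mult_right_mono) auto
        then show "K * r n \<le> M n * r' n" by (simp add: r' mult.assoc)
      qed (use K r_pos[of n] r'_pos[of n] Mn in auto)
      then have "M n powr k * \<psi> (K * r n) \<le> Q"
        using n(5) mult_left_mono[of "\<psi> (K * r n)" "\<psi> (M n * r' n)" "M n powr k"] by simp
      then have cost: "C * K powr k * (M n powr k * \<psi> (K * r n)) \<le> C * K powr k * Q"
        using C by (intro mult_left_mono) auto
      have "K * r n / e = K * M n" using r_pos[of n] Mn by (simp add: e_def)
      then have "C * (K * r n / e) powr k * \<psi> (K * r n) \<le> C * K powr k * Q"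
        using cost K Mn by (simp add: powr_mult mult.assoc)
      moreover have "0 < e" using r_pos[of n] Mn by (simp add: e_def)
      moreover have "e \<le> diameter S"
      proof -
        have "r n / c < diameter S" using n(3) c(1) by (simp add: pos_divide_less_eq mult.commute)
        then show ?thesis using e_le by simp
      qed
      moreover have "2 * e \<le> K * r n"
      proof -
        have "2 * e \<le> 2 / c * r n" using e_le by simp
        also have "\<dots> \<le> K * r n" using R r_pos[of n] by (intro mult_right_mono) (auto simp: K_def)
        finally show ?thesis .
      qed
      moreover have "K * r n \<le> \<delta>" using n(2) K by (simp add: field_simps)
      moreover have "dist (f x) (f y) \<le> K * r n" if xy: "x \<in> S" "y \<in> S" "dist x y < 2 * e" for x y
      proof -
        have "M n * dist x y \<le> M n * (2 * e)" using xy(3) Mn(2) by (intro mult_left_mono) auto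
        also have "\<dots> = 2 * r n" using Mn by (simp add: e_def)
        finally have "4 * (R + 4) * (M n * dist x y) \<le> 4 * (R + 4) * (2 * r n)"
          using R by (intro mult_left_mono) auto
        then have "dist (f x) (f y) \<le> (8 * (R + 4) + 8) * r n"
          using osc[OF n(1) xy(1,2)] by (simp add: algebra_simps)
        also have "\<dots> \<le> K * r n" using c r_pos[of n] by (intro mult_right_mono) (auto simp: K_def)
        finally show ?thesis .
      qed
      ultimately show "\<exists>U :: nat \<Rightarrow> ('m \<times> 'b) set. ?\<Gamma> \<subseteq> (\<Union>i. U i) \<and> (\<forall>i. diam_max (U i) \<le> ereal \<delta>) \<and>
          (\<Sum>i. ennreal (?g (real_of_ereal (diam_max (U i))))) \<le> ennreal (C * K powr k * Q)"
        by (intro cover[of e "K * r n"]) auto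
    qed
    then show ?thesis by blast
  qed
  then show ?thesis using ennreal_less_top le_less_trans unfolding infinity_ennreal_def by blast
qed

end
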